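(* Let $Y$ be a diffusion on $I=(l,r)$ solving $dY_t=\sigma(Y_t)\,dW_t+b(Y_t)\,dt$ with $W$ a standard Wiener process, $\sigma,b$ continuous on $I$ and $\sigma>0$ on $I$. Assume $Y$ is transient and $\lim_{t\to\zeta}Y_t=r$ a.s., where $\zeta$ is the lifetime of $Y$. Let $f$ be a positive continuous function on $I$ and suppose $f=(g'\sigma)^2$ on $I$ for some increasing twice continuously differentiable function $g$ on $I$; set $g(r):=\lim_{x\to r}g(x)$. Let $Z$ be the diffusion on $(g(l),g(r))$ solving $dZ_t=d\widetilde W_t+G(g^{-1}(Z_t))\,dt$ with $G(x)=\frac{1}{f(x)}\big(\tfrac12\sigma(x)^2g''(x)+b(x)g'(x)\big)$ (equivalently $Z_t=g(Y_{a_t})$ with $a$ the inverse of $t\mapsto\int_0^t f(Y_s)ds$). Then $A_\zeta(f):=\int_0^\zeta f(Y_s)\,ds<\infty$ a.s. if and only if $g(r)$ is an exit boundary for $Z$, i.e. $$\int_c^{g(r)}S^Z(d\alpha)\int_c^{\alpha}m^Z(d\beta)<\infty$$ for some (equivalently any) $c\in(g(l),g(r))$, where $S^Z(d\alpha)=e^{-B^Z(\alpha)}d\alpha$, $m^Z(d\beta)=2e^{B^Z(\beta)}d\beta$, $B^Z(\beta)=2\int^\beta G(g^{-1}(z))\,dz$. Furthermore this condition is equivalent to $$\int_c^{r}\big(S^Y(r)-S^Y(v)\big)\,f(v)\,m^Y(dv)<\infty$$ for some (equivalently any) $c\in(l,r)$, where $m^Y(dx)=2\sigma^{-2}(x)e^{B^Y(x)}dx$,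 $S^Y(dx)=e^{-B^Y(x)}dx$, $B^Y(x)=2\int^x \frac{b(z)}{\sigma^2(z)}dz$, and $S^Y(r)=\lim_{v\to r}S^Y(v)$.
   Context: Here $S^Y$ denotes a scale function of $Y$ (an antiderivative of $e^{-B^Y}$) and $m^Y$ its speed measure; $B^Y$ and $B^Z$ are defined up to an additive constant, which does not affect the conditions. (The paper prints the speed density of $Y$ as $2\sigma^2e^{B^Y}$, but the standard normalization, consistent with its proof, is $2\sigma^{-2}e^{B^Y}$.) *)

theory Defs
  imports "HOL-Probability.Probability"
begin

definition ivl :: "ereal \<Rightarrow> ereal \<Rightarrow> real set" where
  "ivl l r = {x. l < ereal x \<and> ereal x < r}"

definition at_left_e :: "ereal \<Rightarrow> real filter" where
  "at_left_e z = (if z = \<infinity> then at_top else at_left (real_of_ereal z))"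

definition at_right_e :: "ereal \<Rightarrow> real filter" where
  "at_right_e z = (if z = -\<infinity> then at_bot else at_right (real_of_ereal z))"

definition martingale :: "'a measure \<Rightarrow> (real \<Rightarrow> 'a measure) \<Rightarrow> (real \<Rightarrow> 'a \<Rightarrow> real) \<Rightarrow> bool" where
  "martingale M F X \<longleftrightarrow>
     (\<forall>t\<ge>0. integrable M (X t) \<and> X t \<in> borel_measurable (F t)) \<and>
     (\<forall>s t A. 0 \<le> s \<longrightarrow> s \<le> t \<longrightarrow> A \<in> sets (F s) \<longrightarrow>
        (LINT x:A|M. X t x) = (LINT x:A|M. X s x))"

definition exit_time :: "(real \<Rightarrow> 'a \<Rightarrow> real) \<Rightarrow> ('a \<Rightarrow> ereal) \<Rightarrow> real \<Rightarrow> real \<Rightarrow> 'a \<Rightarrow> ereal" where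
  "exit_time Y \<zeta> a b \<omega> =
     min (\<zeta> \<omega>) (Inf (ereal ` {t. 0 \<le> t \<and> ereal t < \<zeta> \<omega> \<and> Y t \<omega> \<notin> {a<..<b}}))"

text \<open>Y (with lifetime \<zeta>, filtration F on the probability space M) is a (weak) solution of
  dY = \<sigma>(Y) dW + b(Y) dt on I = (l,r) up to its explosion time \<zeta>, expressed through the
  (localised) martingale problem for the generator L\<phi> = \<sigma>^2 \<phi>''/2 + b \<phi>'.\<close>
definition diffusion ::
  "'a measure \<Rightarrow> (real \<Rightarrow> 'a measure) \<Rightarrow> (real \<Rightarrow> 'a \<Rightarrow> real) \<Rightarrow> ('a \<Rightarrow> ereal) \<Rightarrow>
   ereal \<Rightarrow> ereal \<Rightarrow> (real \<Rightarrow> real) \<Rightarrow> (real \<Rightarrow> real) \<Rightarrow> bool" where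
  "diffusion M F Y \<zeta> l r \<sigma> b \<longleftrightarrow>
     prob_space M \<and> filtration (space M) F \<and> (\<forall>t. sets (F t) \<subseteq> sets M) \<and>
     (\<forall>\<omega>\<in>space M. 0 < \<zeta> \<omega> \<and>
        continuous_on {t. 0 \<le> t \<and> ereal t < \<zeta> \<omega>} (\<lambda>t. Y t \<omega>) \<and>
        (\<forall>t. 0 \<le> t \<and> ereal t < \<zeta> \<omega> \<longrightarrow> Y t \<omega> \<in> ivl l r)) \<and>
     (AE \<omega> in M. \<zeta> \<omega> < \<infinity> \<longrightarrow>
        (\<forall>K. compact K \<and> K \<subseteq> ivl l r \<longrightarrow> (\<forall>\<^sub>F t in at_left_e (\<zeta> \<omega>). Y t \<omega> \<notin> K))) \<and>
     (\<forall>a b' \<phi> \<phi>' \<phi>''. {a..b'} \<subseteq> ivl l r \<and>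
        (\<forall>x. (\<phi> has_real_derivative \<phi>' x) (at x)) \<and>
        (\<forall>x. (\<phi>' has_real_derivative \<phi>'' x) (at x)) \<and> continuous_on UNIV \<phi>'' \<longrightarrow>
        martingale M F (\<lambda>t \<omega>.
          let u = real_of_ereal (min (ereal t) (exit_time Y \<zeta> a b' \<omega>)) in
          \<phi> (Y u \<omega>) - \<phi> (Y 0 \<omega>) -
          (LINT s:{0..u}|lborel. (\<sigma> (Y s \<omega>))\<^sup>2 * \<phi>'' (Y s \<omega>) / 2 + b (Y s \<omega>) * \<phi>' (Y s \<omega>))))"

definition transient ::
  "'a measure \<Rightarrow> (real \<Rightarrow> 'a \<Rightarrow> real) \<Rightarrow> ('a \<Rightarrow> ereal) \<Rightarrow> ereal \<Rightarrow> ereal \<Rightarrow> bool" where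
  "transient M Y \<zeta> l r \<longleftrightarrow>
     (AE \<omega> in M. \<forall>K. compact K \<and> K \<subseteq> ivl l r \<longrightarrow>
        (\<exists>s. \<forall>t. s \<le> t \<and> ereal t < \<zeta> \<omega> \<longrightarrow> Y t \<omega> \<notin> K))"

definition additive_functional ::
  "(real \<Rightarrow> 'a \<Rightarrow> real) \<Rightarrow> ('a \<Rightarrow> ereal) \<Rightarrow> (real \<Rightarrow> real) \<Rightarrow> 'a \<Rightarrow> ennreal" where
  "additive_functional Y \<zeta> f \<omega> =
     (\<integral>\<^sup>+ s\<in>{s. 0 \<le> s \<and> ereal s < \<zeta> \<omega>}. ennreal (f (Y s \<omega>)) \<partial>lborel)"

text \<open>Drift of Z (as a function of x = g^{-1}(z)).\<close>
definition driftG :: "(real \<Rightarrow> real) \<Rightarrow> (real \<Rightarrow> real) \<Rightarrow> (real \<Rightarrow> real) \<Rightarrow> (real \<Rightarrow> real)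
    \<Rightarrow> (real \<Rightarrow> real) \<Rightarrow> real \<Rightarrow> real" where
  "driftG \<sigma> b f g1 g2 x = (1 / f x) * ((1/2) * (\<sigma> x)\<^sup>2 * g2 x + b x * g1 x)"

definition BZ :: "real set \<Rightarrow> (real \<Rightarrow> real) \<Rightarrow> (real \<Rightarrow> real) \<Rightarrow> real \<Rightarrow> real \<Rightarrow> real" where
  "BZ I g G c \<beta> = 2 * (LBINT z=ereal c..ereal \<beta>. G (inv_into I g z))"

definition Z_exit_integral ::
  "real set \<Rightarrow> (real \<Rightarrow> real) \<Rightarrow> (real \<Rightarrow> real) \<Rightarrow> ereal \<Rightarrow> real \<Rightarrow> ennreal" where
  "Z_exit_integral I g G gr c =
     (\<integral>\<^sup>+ \<alpha>\<in>{\<alpha>. c < \<alpha> \<and> ereal \<alpha> < gr}.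
        ennreal (exp (- BZ I g G c \<alpha>)) *
        (\<integral>\<^sup>+ \<beta>\<in>{c<..<\<alpha>}. ennreal (2 * exp (BZ I g G c \<beta>)) \<partial>lborel) \<partial>lborel)"

definition BY :: "(real \<Rightarrow> real) \<Rightarrow> (real \<Rightarrow> real) \<Rightarrow> real \<Rightarrow> real \<Rightarrow> real" where
  "BY \<sigma> b c x = 2 * (LBINT z=ereal c..ereal x. b z / (\<sigma> z)\<^sup>2)"

text \<open>int_c^r (S^Y(r) - S^Y(v)) f(v) m^Y(dv), where S^Y(r) - S^Y(v) = S^Y((v,r)) = int_v^r e^{-B^Y}.\<close>
definition Y_integral ::
  "(real \<Rightarrow> real) \<Rightarrow> (real \<Rightarrow> real) \<Rightarrow> (real \<Rightarrow> real) \<Rightarrow> ereal \<Rightarrow> real \<Rightarrow> ennreal" where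
  "Y_integral \<sigma> b f r c =
     (\<integral>\<^sup>+ v\<in>{v. c < v \<and> ereal v < r}.
        (\<integral>\<^sup>+ x\<in>{x. v < x \<and> ereal x < r}. ennreal (exp (- BY \<sigma> b c x)) \<partial>lborel) *
        ennreal (f v) * ennreal (2 / (\<sigma> v)\<^sup>2 * exp (BY \<sigma> b c v)) \<partial>lborel)"

end

theory Submission
  imports Defs "HOL-Real_Asymp.Real_Asymp"
begin

text \<open>
Let w solve the equation L w = f for the generator L of Y, with w(c) = w'(c) = 0, that is
w(x) = int_c^x e^{-B} int_c^y f e^B 2/sigma^2. Both integral criteria (by Tonelli for Y, and by the
change of variables z = g(x) for Z) say that w stays bounded near r. The process
N_t = w(Y_t) - w(Y_0) - int_0^t f(Y_s) ds, stopped when Y leaves a compact interval, is a continuous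
martingale with expectation 0.

If w is unbounded near r while the additive functional is finite, then N tends to infinity at the
lifetime and, having continuous paths, is bounded below. But stopping at the level -K shows that N
reaches R before -K with probability at most K/(R+K), a contradiction as R tends to infinity.
If w is bounded by C on (a,r), then int_0^t f(Y_s) ds is at most C - N_t until Y leaves (a,r),
and Markov's inequality for C - N bounds its tails; every path stays above some such a.

Since the criterion for each base point c is equivalent to the same almost sure statement, its
independence of c needs no separate argument.
\<close>

text \<open>The martingale problem speaks only of exits from compact subintervals and of integrals
  over sets of \<open>F s\<close> at deterministic times, so nothing is given directly at the
  lifetime. Stopping at a level is therefore done on grids of deterministic times, where it uses the
  martingale equality on finitely many events. Moreover each probability estimate concerns one
  compact interval \<open>k\<close> and one time \<open>n\<close>, with a bound that depends on
  neither. The conclusion about paths is that, almost surely, the estimated events cannot occur at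
  every level \<open>R\<close> for all large \<open>k\<close> and, given \<open>k\<close>, all large
  \<open>n\<close>. Thus measurability of the additive functional and of the exit times never
  enters. What remains dependent on the path is a single constant (how low N gets, or how far to the
  left Y gets); it is coded by an integer \<open>m\<close>, so that countably many null sets exhaust
  it. When w is bounded near r the left end of the intervals has to stay fixed, because w may still
  be unbounded near l.\<close>

section \<open>Martingales indexed by real time\<close>

text \<open>
V is the walk x stopped on reaching level -K. At the stopping time it may overshoot the level, but
by no more than the largest step d; for the path sampled on ever finer grids d tends to 0.
\<close>

lemma stopped_walk:
  fixes x :: "nat \<Rightarrow> real"
  assumes x0: "x 0 = 0" and K: "0 < K" and osc: "\<And>j. j < n \<Longrightarrow> \<bar>x (Suc j) - x j\<bar> \<le> d"
    and d: "0 \<le> d" and "m \<le> n"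
  defines "V \<equiv> \<lambda>m. \<Sum>j<m. if \<forall>i\<le>j. - K < x i then x (Suc j) - x j else 0"
  shows "((\<forall>i<m. - K < x i) \<longrightarrow> V m = x m) \<and> - K - d \<le> V m"
  using \<open>m \<le> n\<close>
proof (induction m)
  case 0
  then show ?case using x0 K d by (auto simp: V_def)
next
  case (Suc m)
  have IH: "(\<forall>i<m. - K < x i) \<longrightarrow> V m = x m" "- K - d \<le> V m" using Suc by auto
  have V: "V (Suc m) = V m + (if \<forall>i\<le>m. - K < x i then x (Suc m) - x m else 0)"
    by (simp add: V_def)
  show ?case
  proof (cases "\<forall>i\<le>m. - K < x i")
    case True
    then have "V m = x m" "- K < x m" using IH by auto
    then show ?thesis using True V osc[of m] Suc.prems by auto
  next
    case False
    then show ?thesis using IH V by (auto simp: less_Suc_eq_le)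
  qed
qed

lemma martingale_adapted:
  assumes "filtration (space M) F" "\<forall>t. sets (F t) \<subseteq> sets M" "martingale M F X" "0 \<le> s" "s \<le> t"
  shows "X s \<in> borel_measurable (F t)"
proof -
  interpret filtration "space M" F by fact
  have "X s \<in> borel_measurable (F s)" using assms by (auto simp: martingale_def)
  then show ?thesis
    using sets_F_mono[OF assms(5)] space_F by (auto simp: measurable_def)
qed

lemma martingale_integral_const:
  assumes "filtration (space M) F" "martingale M F X" "0 \<le> t"
  shows "(LINT \<omega>|M. X t \<omega>) = (LINT \<omega>|M. X 0 \<omega>)"
proof -
  interpret filtration "space M" F by fact
  have "(LINT \<omega>:space M|M. X t \<omega>) = (LINT \<omega>:space M|M. X 0 \<omega>)"
    using assms sets.top[of "F 0"] unfolding martingale_def space_F by auto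
  then show ?thesis by (simp add: set_integral_space set_lebesgue_integral_def cong: Bochner_Integration.integral_cong)
qed

text \<open>The walk stopped at \<open>-K\<close> has mean 0, is never below \<open>-K\<close> by
  more than the largest step, and equals \<open>X t \<ge> R\<close> on \<open>D\<close>. Taking the
  mean of the nonnegative variable \<open>V + K + d\<close> is then a Markov estimate whose only
  error is the mean largest step.\<close>

lemma martingale_lower_barrier_grid:
  assumes M: "prob_space M" and F: "filtration (space M) F" "\<forall>t. sets (F t) \<subseteq> sets M"
    and X: "martingale M F X" "AE \<omega> in M. X 0 \<omega> = 0"
    and t: "0 < t" and K: "0 < K" and R: "0 < R" and n: "0 < n"
    and D: "D \<in> sets M"
      "\<And>\<omega>. \<omega> \<in> D \<Longrightarrow> R \<le> X t \<omega> \<and> (\<forall>j\<le>n. - K < X (t * (real j / real n)) \<omega>)"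
  shows "(R + K) * measure M D \<le> K +
    (LINT \<omega>|M. Max ((\<lambda>j. \<bar>X (t * (real (Suc j) / real n)) \<omega> - X (t * (real j / real n)) \<omega>\<bar>) ` {..<n}))"
proof -
  interpret prob_space M by fact
  interpret filtration "space M" F by fact
  define x where "x j \<omega> = X (t * (real j / real n)) \<omega>" for j \<omega>
  define d where "d \<omega> = Max ((\<lambda>j. \<bar>x (Suc j) \<omega> - x j \<omega>\<bar>) ` {..<n})" for \<omega>
  \<comment> \<open>The event that step \<open>j\<close> is still taken. It is decided by the values
    up to the \<open>j\<close>-th grid time, hence belongs to \<open>F\<close> there, and so the
    increment over step \<open>j\<close> integrates to 0 on it.\<close>
  define I where "I j = {\<omega> \<in> space M. \<forall>i\<le>j. - K < x i \<omega>}" for j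
  define V where "V m \<omega> = (\<Sum>j<m. if \<forall>i\<le>j. - K < x i \<omega> then x (Suc j) \<omega> - x j \<omega> else 0)" for m \<omega>
  have int[simp]: "integrable M (x j)" for j
    using X t unfolding x_def martingale_def by auto
  have xm[measurable]: "x j \<in> borel_measurable M" for j using int by (rule borel_measurable_integrable)
  have IF: "I j \<in> sets (F (t * (real j / real n)))" for j
  proof -
    have [measurable]: "x i \<in> borel_measurable (F (t * (real j / real n)))" if "i \<le> j" for i
      unfolding x_def using that t n
      by (intro martingale_adapted[OF F X(1)]) (auto intro!: mult_left_mono divide_right_mono)
    have "{\<omega> \<in> space (F (t * (real j / real n))). \<forall>i\<in>{..j}. - K < x i \<omega>} \<in> sets (F (t * (real j / real n)))"
      by measurable
    also have "{\<omega> \<in> space (F (t * (real j / real n))). \<forall>i\<in>{..j}. - K < x i \<omega>} = I j"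
      unfolding I_def space_F by auto
    finally show ?thesis .
  qed
  have IM[measurable]: "I j \<in> sets M" for j using IF F(2) by blast
  have Ve: "V m \<omega> = (\<Sum>j<m. indicator (I j) \<omega> *\<^sub>R x (Suc j) \<omega> - indicator (I j) \<omega> *\<^sub>R x j \<omega>)" if "\<omega> \<in> space M" for m \<omega>
    unfolding V_def using that by (intro sum.cong) (auto simp: I_def indicator_def)
  have si: "integrable M (\<lambda>\<omega>. indicator (I j) \<omega> *\<^sub>R x i \<omega>)" for i j
    by (intro integrable_mult_indicator) auto
  have eqI: "(LINT \<omega>|M. indicator (I j) \<omega> *\<^sub>R x (Suc j) \<omega>) = (LINT \<omega>|M. indicator (I j) \<omega> *\<^sub>R x j \<omega>)" for j
  proof -
    have "t * (real j / real n) \<le> t * (real (Suc j) / real n)" "0 \<le> t * (real j / real n)"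
      using t n by (auto intro!: mult_left_mono divide_right_mono)
    then have "(LINT x:I j|M. X (t * (real (Suc j) / real n)) x) = (LINT x:I j|M. X (t * (real j / real n)) x)"
      using X(1) IF[of j] unfolding martingale_def by blast
    then show ?thesis unfolding set_lebesgue_integral_def x_def .
  qed
  have intV: "integrable M (V n)"
    by (rule Bochner_Integration.integrable_cong[THEN iffD2, OF refl Ve]) (auto simp del: real_scaleR_def intro!: si)
  have EV: "(LINT \<omega>|M. V n \<omega>) = 0"
  proof -
    have "(LINT \<omega>|M. V n \<omega>) = (LINT \<omega>|M. (\<Sum>j<n. indicator (I j) \<omega> *\<^sub>R x (Suc j) \<omega> - indicator (I j) \<omega> *\<^sub>R x j \<omega>))"
      by (rule Bochner_Integration.integral_cong[OF refl Ve])
    also have "\<dots> = 0" using si eqI by (simp del: real_scaleR_def)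
    finally show ?thesis .
  qed
  have intd: "integrable M d"
  proof (rule Bochner_Integration.integrable_bound)
    show "integrable M (\<lambda>\<omega>. \<Sum>j<n. \<bar>x (Suc j) \<omega> - x j \<omega>\<bar>)" by auto
    show "d \<in> borel_measurable M" unfolding d_def by measurable
    show "AE \<omega> in M. norm (d \<omega>) \<le> norm (\<Sum>j<n. \<bar>x (Suc j) \<omega> - x j \<omega>\<bar>)"
    proof (rule AE_I2)
      fix \<omega>
      have "d \<omega> \<in> (\<lambda>j. \<bar>x (Suc j) \<omega> - x j \<omega>\<bar>) ` {..<n}"
        unfolding d_def using n by (intro Max_in) (auto simp: lessThan_empty_iff)
      then obtain j where j: "j < n" "d \<omega> = \<bar>x (Suc j) \<omega> - x j \<omega>\<bar>" by auto
      have "\<bar>x (Suc j) \<omega> - x j \<omega>\<bar> \<le> (\<Sum>j<n. \<bar>x (Suc j) \<omega> - x j \<omega>\<bar>)"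
        using j by (intro member_le_sum) auto
      then show "norm (d \<omega>) \<le> norm (\<Sum>j<n. \<bar>x (Suc j) \<omega> - x j \<omega>\<bar>)" using j by auto
    qed
  qed
  have "(R + K) * measure M D = (LINT \<omega>|M. (R + K) * indicator D \<omega>)"
    using D(1) by simp
  also have "\<dots> \<le> (LINT \<omega>|M. V n \<omega> + K + d \<omega>)"
  proof (rule integral_mono_AE)
    show "integrable M (\<lambda>\<omega>. (R + K) * indicator D \<omega>)" using D(1)
      by (intro integrable_mult_right) (auto simp: less_top[symmetric])
    show "integrable M (\<lambda>\<omega>. V n \<omega> + K + d \<omega>)" using intV intd by auto
    show "AE \<omega> in M. (R + K) * indicator D \<omega> \<le> V n \<omega> + K + d \<omega>"
      using X(2)
    proof eventually_elim
      case (elim \<omega>)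
      have dj: "\<bar>x (Suc j) \<omega> - x j \<omega>\<bar> \<le> d \<omega>" if "j < n" for j
        unfolding d_def using that by (intro Max_ge) auto
      have d0: "0 \<le> d \<omega>" using dj[of 0] n by auto
      have x0: "x 0 \<omega> = 0" using elim by (simp add: x_def)
      have *: "((\<forall>i<n. - K < x i \<omega>) \<longrightarrow> V n \<omega> = x n \<omega>) \<and> - K - d \<omega> \<le> V n \<omega>"
        unfolding V_def
        using stopped_walk[where x = "\<lambda>j. x j \<omega>" and K = K and n = n and d = "d \<omega>" and m = n] x0 K dj d0
        by simp
      show ?case
      proof (cases "\<omega> \<in> D")
        case True
        from D(2)[OF this] have "R \<le> x n \<omega>" "\<forall>i<n. - K < x i \<omega>" using n by (auto simp: x_def)
        then show ?thesis using * True d0 by auto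
      qed (use * in auto)
    qed
  qed
  also have "\<dots> = K + (LINT \<omega>|M. d \<omega>)" using intV intd EV by (simp add: prob_space)
  finally show ?thesis by (simp add: d_def x_def)
qed

text \<open>Uniform continuity of the paths on \<open>{0..t}\<close> sends the largest grid step to
  0, and the bound \<open>C\<close> lets its mean follow. The barrier is imposed only at rational
  fractions of \<open>t\<close>: they contain every grid and amount to countably many conditions.
  What is left is the ruin probability of a fair game between \<open>-K\<close> and
  \<open>R\<close>.\<close>

lemma martingale_lower_barrier:
  assumes M: "prob_space M" and F: "filtration (space M) F" "\<forall>t. sets (F t) \<subseteq> sets M"
    and X: "martingale M F X" "AE \<omega> in M. X 0 \<omega> = 0"
    and cont: "AE \<omega> in M. continuous_on {0..t} (\<lambda>s. X s \<omega>)"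
    and bdd: "AE \<omega> in M. \<forall>s\<in>{0..t}. \<bar>X s \<omega>\<bar> \<le> C"
    and t: "0 < t" and K: "0 < K" and R: "0 < R"
    and D: "D \<in> sets M"
      "\<And>\<omega>. \<omega> \<in> D \<Longrightarrow> R \<le> X t \<omega>"
      "\<And>\<omega> i j. \<omega> \<in> D \<Longrightarrow> i \<le> j \<Longrightarrow> 0 < j \<Longrightarrow> - K < X (t * (real i / real j)) \<omega>"
  shows "measure M D \<le> K / (R + K)"
proof -
  interpret prob_space M by fact
  define d where "d n \<omega> = Max ((\<lambda>j. \<bar>X (t * (real (Suc j) / real n)) \<omega> - X (t * (real j / real n)) \<omega>\<bar>) ` {..<n})" for n \<omega>
  have le: "(R + K) * measure M D \<le> K + (LINT \<omega>|M. d (Suc n) \<omega>)" for n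
    unfolding d_def by (rule martingale_lower_barrier_grid[OF M F X t K R]) (use D(2,3) in \<open>auto intro!: D(1) simp del: of_nat_Suc times_divide_eq_right\<close>)
  have grid: "t * (real j / real n) \<in> {0..t}" if "j \<le> n" "0 < n" for j n
    using that t by (auto simp: field_simps)
  have Xm: "X s \<in> borel_measurable M" if "0 \<le> s" for s
    using X(1) that unfolding martingale_def by (meson borel_measurable_integrable)
  have dex: "\<exists>j\<le>n. d (Suc n) \<omega> = \<bar>X (t * (real (Suc j) / real (Suc n))) \<omega> - X (t * (real j / real (Suc n))) \<omega>\<bar>" for n \<omega>
  proof -
    have "d (Suc n) \<omega> \<in> (\<lambda>j. \<bar>X (t * (real (Suc j) / real (Suc n))) \<omega> - X (t * (real j / real (Suc n))) \<omega>\<bar>) ` {..<Suc n}"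
      unfolding d_def by (intro Max_in) auto
    then obtain j where "j < Suc n" "d (Suc n) \<omega> = \<bar>X (t * (real (Suc j) / real (Suc n))) \<omega> - X (t * (real j / real (Suc n))) \<omega>\<bar>"
      by blast
    then show ?thesis by (intro exI[of _ j]) (simp only: less_Suc_eq_le simp_thms)
  qed
  have "(\<lambda>n. LINT \<omega>|M. d (Suc n) \<omega>) \<longlonglongrightarrow> (LINT \<omega>|M. 0)"
  \<comment> \<open>A step is the difference of two values bounded by \<open>C\<close>, whence the
    dominating constant.\<close>
  proof (rule integral_dominated_convergence[where w="\<lambda>_. 2 * C"])
    show "(\<lambda>_. 0) \<in> borel_measurable M" "integrable M (\<lambda>_. 2 * C)" by auto
    show "d (Suc n) \<in> borel_measurable M" for n unfolding d_def
    proof (intro borel_measurable_Max)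
      fix j assume "j \<in> {..<Suc n}"
      then have "X (t * (real (Suc j) / real (Suc n))) \<in> borel_measurable M" "X (t * (real j / real (Suc n))) \<in> borel_measurable M"
        using grid[of "Suc j" "Suc n"] grid[of j "Suc n"] by (auto intro!: Xm)
      then show "(\<lambda>\<omega>. \<bar>X (t * (real (Suc j) / real (Suc n))) \<omega> - X (t * (real j / real (Suc n))) \<omega>\<bar>) \<in> borel_measurable M"
        by measurable
    qed auto
    show "AE \<omega> in M. norm (d (Suc n) \<omega>) \<le> 2 * C" for n
      using bdd
    proof eventually_elim
      case (elim \<omega>)
      obtain j where j: "j \<le> n" "d (Suc n) \<omega> = \<bar>X (t * (real (Suc j) / real (Suc n))) \<omega> - X (t * (real j / real (Suc n))) \<omega>\<bar>"
        using dex by blast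
      have "\<bar>X (t * (real (Suc j) / real (Suc n))) \<omega>\<bar> \<le> C" "\<bar>X (t * (real j / real (Suc n))) \<omega>\<bar> \<le> C"
        using elim grid[of "Suc j" "Suc n"] grid[of j "Suc n"] j by auto
      then show ?case using j by auto
    qed
    show "AE \<omega> in M. (\<lambda>n. d (Suc n) \<omega>) \<longlonglongrightarrow> 0"
      using cont
    proof eventually_elim
      case (elim \<omega>)
      then have uc: "uniformly_continuous_on {0..t} (\<lambda>s. X s \<omega>)"
        by (intro compact_uniformly_continuous) auto
      show ?case
      proof (rule LIMSEQ_I)
        fix e :: real assume e: "0 < e"
        then obtain \<delta> where \<delta>: "0 < \<delta>" "\<And>x y. x \<in> {0..t} \<Longrightarrow> y \<in> {0..t} \<Longrightarrow> dist y x < \<delta> \<Longrightarrow> dist (X y \<omega>) (X x \<omega>) < e"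
          using uc unfolding uniformly_continuous_on_def by meson
        obtain N where N: "t / \<delta> < real N" using reals_Archimedean2 by blast
        show "\<exists>no. \<forall>n\<ge>no. norm (d (Suc n) \<omega> - 0) < e"
        proof (intro exI allI impI)
          fix n assume n: "N \<le> n"
          obtain j where j: "j \<le> n" "d (Suc n) \<omega> = \<bar>X (t * (real (Suc j) / real (Suc n))) \<omega> - X (t * (real j / real (Suc n))) \<omega>\<bar>"
            using dex by blast
          have "t * (real (Suc j) / real (Suc n)) - t * (real j / real (Suc n)) = t / real (Suc n)"
            by (simp add: add_divide_distrib distrib_left)
          moreover have "t / real (Suc n) < \<delta>"
          proof -
            have "t / \<delta> < real (Suc n)" using N n by linarith
            then show ?thesis using \<delta>(1) t by (simp add: field_simps)
          qed
          moreover have "0 \<le> t / real (Suc n)" using t by auto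
          ultimately have "dist (t * (real (Suc j) / real (Suc n))) (t * (real j / real (Suc n))) < \<delta>"
            unfolding dist_real_def by linarith
          then have "dist (X (t * (real (Suc j) / real (Suc n))) \<omega>) (X (t * (real j / real (Suc n))) \<omega>) < e"
            using grid[of "Suc j" "Suc n"] grid[of j "Suc n"] j by (intro \<delta>(2)) auto
          then show "norm (d (Suc n) \<omega> - 0) < e" using j by (simp add: dist_real_def)
        qed
      qed
    qed
  qed
  then have "(\<lambda>n. K + (LINT \<omega>|M. d (Suc n) \<omega>)) \<longlonglongrightarrow> K + 0" by (intro tendsto_intros) simp
  then have "(R + K) * measure M D \<le> K + 0"
    by (rule LIMSEQ_le_const) (use le in auto)
  then show ?thesis using K R by (simp add: field_simps)
qed

section \<open>Null sets from iterated limits of events\<close>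

lemma (in prob_space) prob_eventually_le:
  assumes A: "\<And>n. A n \<in> events" and le: "eventually (\<lambda>n. prob (A n) \<le> \<delta>) sequentially"
  shows "{\<omega> \<in> space M. \<forall>\<^sub>F n in sequentially. \<omega> \<in> A n} \<in> events"
    and "prob {\<omega> \<in> space M. \<forall>\<^sub>F n in sequentially. \<omega> \<in> A n} \<le> \<delta>"
proof -
  define B where "B m = {\<omega> \<in> space M. \<forall>n\<ge>m. \<omega> \<in> A n}" for m
  have eq: "{\<omega> \<in> space M. \<forall>\<^sub>F n in sequentially. \<omega> \<in> A n} = (\<Union>m. B m)"
    by (auto simp: B_def eventually_sequentially)
  have Bm[measurable]: "B m \<in> events" for m unfolding B_def using A by measurable
  show "{\<omega> \<in> space M. \<forall>\<^sub>F n in sequentially. \<omega> \<in> A n} \<in> events" unfolding eq by measurable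
  have "(\<lambda>m. prob (B m)) \<longlonglongrightarrow> prob (\<Union>m. B m)"
  proof (rule finite_Lim_measure_incseq)
    show "range B \<subseteq> events" using Bm by blast
    show "incseq B" by (force simp: B_def incseq_def)
  qed
  \<comment> \<open>\<open>B m\<close> lies in \<open>A n\<close> for every
    \<open>n \<ge> m\<close>, and some such \<open>n\<close> obeys the bound; the increasing union
    of the \<open>B m\<close> inherits it.\<close>
  moreover have "prob (B m) \<le> \<delta>" for m
  proof -
    obtain n where "m \<le> n" "prob (A n) \<le> \<delta>" using le unfolding eventually_sequentially
      by (meson nle_le)
    moreover have "prob (B m) \<le> prob (A n)"
      by (rule finite_measure_mono[OF _ A]) (use \<open>m \<le> n\<close> in \<open>auto simp: B_def\<close>)
    ultimately show ?thesis by linarith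
  qed
  ultimately have "prob (\<Union>m. B m) \<le> \<delta>" by (intro LIMSEQ_le_const2) auto
  then show "prob {\<omega> \<in> space M. \<forall>\<^sub>F n in sequentially. \<omega> \<in> A n} \<le> \<delta>" unfolding eq .
qed

text \<open>The bound survives both limits, so for fixed \<open>m\<close> the intersection over
  \<open>R\<close> has probability at most \<open>c m / (1 + R)\<close> for every \<open>R\<close>
  and is null. In the applications \<open>k\<close> numbers the exhausting intervals,
  \<open>n\<close> is the time, \<open>R\<close> the level and \<open>m\<close> the constant that
  depends on the path.\<close>

lemma (in prob_space) AE_not_eventually:
  fixes A :: "nat \<Rightarrow> nat \<Rightarrow> nat \<Rightarrow> nat \<Rightarrow> 'a set"
  assumes A: "\<And>m R k n. A m R k n \<in> events"
    and le: "\<And>m R. \<forall>\<^sub>F k in sequentially. \<forall>\<^sub>F n in sequentially. prob (A m R k n) \<le> c m / (1 + real R)"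
  shows "AE \<omega> in M. \<not> (\<exists>m. \<forall>R. \<forall>\<^sub>F k in sequentially. \<forall>\<^sub>F n in sequentially. \<omega> \<in> A m R k n)"
proof -
  define H where "H m R k = {\<omega> \<in> space M. \<forall>\<^sub>F n in sequentially. \<omega> \<in> A m R k n}" for m R k
  define G where "G m R = {\<omega> \<in> space M. \<forall>\<^sub>F k in sequentially. \<omega> \<in> H m R k}" for m R
  \<comment> \<open>The bound 1 holds for all events; only measurability is extracted, for every
    \<open>k\<close> and not just the large ones.\<close>
  have H: "H m R k \<in> events" for m R k
    unfolding H_def by (rule prob_eventually_le(1)[of _ 1]) (use A in auto)
  have "\<forall>\<^sub>F k in sequentially. prob (H m R k) \<le> c m / (1 + real R)" for m R
    using le[of m R]
  proof eventually_elim
    case (elim k)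
    then show ?case unfolding H_def by (intro prob_eventually_le(2) A)
  qed
  note G = prob_eventually_le[of "H m R" for m R, OF H this, folded G_def]
  have "AE \<omega> in M. \<not> (\<forall>R. \<omega> \<in> G m R)" for m
  proof -
    have ev: "(\<Inter>R. G m R) \<in> events" using G by auto
    have "prob (\<Inter>R. G m R) \<le> c m / (1 + real R)" for R
      using G(2)[of m R] finite_measure_mono[of "\<Inter>R. G m R" "G m R"] G(1)[of m R] by (auto intro: order_trans)
    moreover have "(\<lambda>R. c m / (1 + real R)) \<longlonglongrightarrow> 0" by real_asymp
    ultimately have "prob (\<Inter>R. G m R) \<le> 0" by (intro LIMSEQ_le_const) auto
    then have "prob (\<Inter>R. G m R) = 0" using measure_nonneg[of M "\<Inter>R. G m R"] by linarith
    then have "(\<Inter>R. G m R) \<in> null_sets M" using ev by (intro null_setsI) (simp_all add: emeasure_eq_measure)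
    then have "AE \<omega> in M. \<omega> \<notin> (\<Inter>R. G m R)" by (rule AE_not_in)
    then show ?thesis by auto
  qed
  then have "AE \<omega> in M. \<forall>m. \<not> (\<forall>R. \<omega> \<in> G m R)" by (simp add: AE_all_countable)
  with AE_space show ?thesis
    by eventually_elim (auto simp: G_def H_def)
qed

section \<open>Intervals and integrals\<close>

lemma ivl_eq_einterval: "ivl l r = einterval l r"
  by (auto simp: ivl_def einterval_def)

lemma ivl_iff: "x \<in> ivl l r \<longleftrightarrow> l < ereal x \<and> ereal x < r"
  by (auto simp: ivl_def einterval_def)

lemma open_ivl: "open (ivl l r)"
  by (simp add: ivl_eq_einterval)

lemma Icc_subset_ivl: "a \<in> ivl l r \<Longrightarrow> b \<in> ivl l r \<Longrightarrow> {a..b} \<subseteq> ivl l r"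
  unfolding ivl_def
  by auto (metis ereal_less_eq(3) less_le_trans, metis ereal_less_eq(3) le_less_trans)

lemma LINT_FTC_Icc:
  fixes H h :: "real \<Rightarrow> real"
  assumes "a \<le> b" "continuous_on {a..b} h"
    "\<And>x. x \<in> {a..b} \<Longrightarrow> (H has_real_derivative h x) (at x)"
  shows "(LINT x:{a..b}|lborel. h x) = H b - H a"
  unfolding set_lebesgue_integral_def
  using assms
  by (intro integral_FTC_atLeastAtMost)
    (auto simp flip: has_real_derivative_iff_has_vector_derivative intro: has_field_derivative_at_within)

lemma nn_integral_Icc_eq_LINT:
  fixes h :: "real \<Rightarrow> real"
  assumes "continuous_on {a..b} h" "\<And>x. x \<in> {a..b} \<Longrightarrow> 0 \<le> h x"
  shows "(\<integral>\<^sup>+x\<in>{a..b}. ennreal (h x) \<partial>lborel) = ennreal (LINT x:{a..b}|lborel. h x)"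
proof -
  have "integrable lborel (\<lambda>x. indicator {a..b} x *\<^sub>R h x)"
    using borel_integrable_atLeastAtMost'[OF assms(1)] by (simp add: set_integrable_def)
  then have "(\<integral>\<^sup>+x. ennreal (indicator {a..b} x *\<^sub>R h x) \<partial>lborel) = ennreal (LINT x:{a..b}|lborel. h x)"
    unfolding set_lebesgue_integral_def
    by (rule nn_integral_eq_integral) (use assms(2) in \<open>auto simp: indicator_def\<close>)
  moreover have "(\<integral>\<^sup>+x\<in>{a..b}. ennreal (h x) \<partial>lborel) = (\<integral>\<^sup>+x. ennreal (indicator {a..b} x *\<^sub>R h x) \<partial>lborel)"
    by (intro nn_integral_cong) (auto simp: indicator_def)
  ultimately show ?thesis by simp
qed

text \<open>Monotone convergence along \<open>{c..u i}\<close> with \<open>u i\<close> increasing to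
  \<open>r\<close>. It serves on the state interval for the integral criteria, and along a single
  path, with the lifetime in place of \<open>r\<close>, for the additive functional.\<close>

lemma nn_integral_Ico_finite_iff:
  fixes h :: "real \<Rightarrow> real" and c :: real and r :: ereal
  assumes cr: "ereal c < r" and cont: "continuous_on {x. c \<le> x \<and> ereal x < r} h"
    and nonneg: "\<And>x. c \<le> x \<Longrightarrow> ereal x < r \<Longrightarrow> 0 \<le> h x"
  shows "(\<integral>\<^sup>+x\<in>{x. c \<le> x \<and> ereal x < r}. ennreal (h x) \<partial>lborel) < \<infinity> \<longleftrightarrow>
    (\<exists>C. \<forall>t. c \<le> t \<longrightarrow> ereal t < r \<longrightarrow> (LINT x:{c..t}|lborel. h x) \<le> C)"
proof -
  let ?S = "{x. c \<le> x \<and> ereal x < r}"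
  have sub: "{c..t} \<subseteq> ?S" if "ereal t < r" for t
    using that by (auto intro: le_less_trans[of _ "ereal t"])
  have eq: "(\<integral>\<^sup>+x\<in>{c..t}. ennreal (h x) \<partial>lborel) = ennreal (LINT x:{c..t}|lborel. h x)" if "ereal t < r" for t
    using sub[OF that] by (intro nn_integral_Icc_eq_LINT continuous_on_subset[OF cont] nonneg) auto
  show ?thesis
  proof
    assume fin: "(\<integral>\<^sup>+x\<in>?S. ennreal (h x) \<partial>lborel) < \<infinity>"
    then obtain C where C: "(\<integral>\<^sup>+x\<in>?S. ennreal (h x) \<partial>lborel) = ennreal C" "0 \<le> C"
      by (cases "\<integral>\<^sup>+x\<in>?S. ennreal (h x) \<partial>lborel") auto
    have "(LINT x:{c..t}|lborel. h x) \<le> C" if "c \<le> t" "ereal t < r" for t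
    proof -
      have "ennreal (LINT x:{c..t}|lborel. h x) \<le> ennreal C"
        unfolding eq[OF that(2), symmetric] C(1)[symmetric]
        using sub[OF that(2)] by (intro nn_integral_mono) (auto simp: indicator_def)
      then show ?thesis using C(2) by simp
    qed
    then show "\<exists>C. \<forall>t. c \<le> t \<longrightarrow> ereal t < r \<longrightarrow> (LINT x:{c..t}|lborel. h x) \<le> C" by blast
  next
    assume "\<exists>C. \<forall>t. c \<le> t \<longrightarrow> ereal t < r \<longrightarrow> (LINT x:{c..t}|lborel. h x) \<le> C"
    then obtain C where C: "\<And>t. c \<le> t \<Longrightarrow> ereal t < r \<Longrightarrow> (LINT x:{c..t}|lborel. h x) \<le> C" by blast
    obtain u where u: "incseq u" "\<And>i. c < u i" "\<And>i. ereal (u i) < r" "(\<lambda>i. ereal (u i)) \<longlonglongrightarrow> r"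
      using ereal_incseq_approx[OF cr] by auto
    \<comment> \<open>Nothing is known of \<open>h\<close> outside \<open>[c, r)\<close>; each
      truncation to a compact interval is measurable because \<open>h\<close> is continuous
      there.\<close>
    define f where "f i x = ennreal (h x) * indicator {c..u i} x" for i x
    have f_meas: "f i \<in> borel_measurable lborel" for i
    proof -
      have "(\<lambda>x. ennreal (indicator {c..u i} x *\<^sub>R h x)) \<in> borel_measurable lborel"
        using borel_integrable_atLeastAtMost'[OF continuous_on_subset[OF cont sub[OF u(3)]], of i]
        unfolding set_integrable_def by (intro measurable_compose[OF _ measurable_ennreal]) auto
      also have "(\<lambda>x. ennreal (indicator {c..u i} x *\<^sub>R h x)) = f i"
        by (auto simp: f_def indicator_def fun_eq_iff)
      finally show ?thesis .
    qed
    have "incseq f"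
      using u(1) by (auto simp: f_def incseq_def le_fun_def indicator_def intro: order_trans)
    have "(\<integral>\<^sup>+x\<in>?S. ennreal (h x) \<partial>lborel) = (\<integral>\<^sup>+x. (SUP i. f i x) \<partial>lborel)"
    proof (rule nn_integral_cong)
      fix x
      show "ennreal (h x) * indicator ?S x = (SUP i. f i x)"
      proof (rule antisym)
        show "(SUP i. f i x) \<le> ennreal (h x) * indicator ?S x"
        proof (rule SUP_least)
          fix i
          show "f i x \<le> ennreal (h x) * indicator ?S x"
            using sub[OF u(3), of i] by (auto simp: f_def indicator_def)
        qed
        show "ennreal (h x) * indicator ?S x \<le> (SUP i. f i x)"
        proof (cases "x \<in> ?S")
          case True
          then have "eventually (\<lambda>i. ereal x < ereal (u i)) sequentially"
            by (intro order_tendstoD(1)[OF u(4)]) auto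
          then obtain i where "x < u i" by (auto simp: eventually_sequentially)
          then have "ennreal (h x) * indicator ?S x \<le> f i x" using True by (auto simp: f_def)
          then show ?thesis by (meson SUP_upper2 UNIV_I)
        qed auto
      qed
    qed
    also have "\<dots> = (SUP i. \<integral>\<^sup>+x. f i x \<partial>lborel)"
      by (intro nn_integral_monotone_convergence_SUP f_meas \<open>incseq f\<close>)
    also have "\<dots> \<le> ennreal C"
    proof (rule SUP_least)
      fix i
      have "(\<integral>\<^sup>+x. f i x \<partial>lborel) = ennreal (LINT x:{c..u i}|lborel. h x)"
        unfolding f_def using eq[OF u(3)] .
      then show "(\<integral>\<^sup>+x. f i x \<partial>lborel) \<le> ennreal C" using C[of "u i"] u(2,3)[of i] by (simp add: ennreal_leI)
    qed
    also have "\<dots> < \<infinity>" by simp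
    finally show "(\<integral>\<^sup>+x\<in>?S. ennreal (h x) \<partial>lborel) < \<infinity>" .
  qed
qed

text \<open>Partial integrals of a derivative are increments of the primitive, and the constant
  \<open>H c\<close> is absorbed into the bound. Applied with \<open>w\<close> itself and with
  \<open>w\<close> composed with the inverse of \<open>g\<close>.\<close>

lemma nn_integral_derivative_finite_iff:
  fixes H h :: "real \<Rightarrow> real" and c :: real and r :: ereal
  assumes cr: "ereal c < r" and cont: "continuous_on {x. c \<le> x \<and> ereal x < r} h"
    and nonneg: "\<And>x. c \<le> x \<Longrightarrow> ereal x < r \<Longrightarrow> 0 \<le> h x"
    and H: "\<And>x. c \<le> x \<Longrightarrow> ereal x < r \<Longrightarrow> (H has_real_derivative h x) (at x)"
  shows "(\<integral>\<^sup>+x\<in>{x. c < x \<and> ereal x < r}. ennreal (h x) \<partial>lborel) < \<infinity> \<longleftrightarrow>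
    (\<exists>C. \<forall>t. c \<le> t \<longrightarrow> ereal t < r \<longrightarrow> H t \<le> C)"
proof -
  have sub: "{c..t} \<subseteq> {x. c \<le> x \<and> ereal x < r}" if "ereal t < r" for t
    using that by (auto intro: le_less_trans[of _ "ereal t"])
  have LI: "(LINT x:{c..t}|lborel. h x) = H t - H c" if "c \<le> t" "ereal t < r" for t
    using that sub[OF that(2)] by (intro LINT_FTC_Icc continuous_on_subset[OF cont] H) auto
  have "(\<integral>\<^sup>+x\<in>{x. c < x \<and> ereal x < r}. ennreal (h x) \<partial>lborel) =
    (\<integral>\<^sup>+x\<in>{x. c \<le> x \<and> ereal x < r}. ennreal (h x) \<partial>lborel)"
    by (intro nn_integral_cong_AE eventually_mono[OF AE_lborel_singleton[of c]])
      (auto simp: indicator_def)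
  then have "(\<integral>\<^sup>+x\<in>{x. c < x \<and> ereal x < r}. ennreal (h x) \<partial>lborel) < \<infinity> \<longleftrightarrow>
    (\<exists>C. \<forall>t. c \<le> t \<longrightarrow> ereal t < r \<longrightarrow> H t - H c \<le> C)"
    using nn_integral_Ico_finite_iff[OF cr cont nonneg] LI by auto
  also have "\<dots> \<longleftrightarrow> (\<exists>C. \<forall>t. c \<le> t \<longrightarrow> ereal t < r \<longrightarrow> H t \<le> C)"
  proof
    assume "\<exists>C. \<forall>t. c \<le> t \<longrightarrow> ereal t < r \<longrightarrow> H t - H c \<le> C"
    then obtain C where "\<forall>t. c \<le> t \<longrightarrow> ereal t < r \<longrightarrow> H t - H c \<le> C" by blast
    then show "\<exists>C. \<forall>t. c \<le> t \<longrightarrow> ereal t < r \<longrightarrow> H t \<le> C"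
      by (intro exI[of _ "C + H c"]) (simp add: diff_le_eq)
  next
    assume "\<exists>C. \<forall>t. c \<le> t \<longrightarrow> ereal t < r \<longrightarrow> H t \<le> C"
    then obtain C where "\<forall>t. c \<le> t \<longrightarrow> ereal t < r \<longrightarrow> H t \<le> C" by blast
    then show "\<exists>C. \<forall>t. c \<le> t \<longrightarrow> ereal t < r \<longrightarrow> H t - H c \<le> C"
      by (intro exI[of _ "C - H c"]) simp
  qed
  finally show ?thesis .
qed

lemma nn_integral_Ioo_derivative:
  fixes H h :: "real \<Rightarrow> real"
  assumes "a \<le> b" "continuous_on {a..b} h" "\<And>x. x \<in> {a..b} \<Longrightarrow> 0 \<le> h x"
    and "\<And>x. x \<in> {a..b} \<Longrightarrow> (H has_real_derivative h x) (at x)"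
  shows "(\<integral>\<^sup>+x\<in>{a<..<b}. ennreal (h x) \<partial>lborel) = ennreal (H b - H a)"
proof -
  have "(\<integral>\<^sup>+x\<in>{a<..<b}. ennreal (h x) \<partial>lborel) = (\<integral>\<^sup>+x\<in>{a..b}. ennreal (h x) \<partial>lborel)"
    by (intro nn_integral_cong_AE
        eventually_mono[OF eventually_conj[OF AE_lborel_singleton[of a] AE_lborel_singleton[of b]]])
      (auto simp: indicator_def)
  then show ?thesis using nn_integral_Icc_eq_LINT[OF assms(2,3)] LINT_FTC_Icc[OF assms(1,2,4)] by simp
qed

lemma LBINT_has_derivative:
  assumes h: "continuous_on (ivl l r) h" and c: "c \<in> ivl l r" and x: "x \<in> ivl l r"
  shows "((\<lambda>x. LBINT z=ereal c..ereal x. h z) has_real_derivative h x) (at x)"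
proof -
  have "open (ivl l r)" by (rule open_ivl)
  then obtain e where e: "0 < e" "cball x e \<subseteq> ivl l r" using x open_contains_cball by blast
  then have xe: "x - e \<in> ivl l r" "x + e \<in> ivl l r" by (auto simp: cball_def dist_real_def subset_iff)
  \<comment> \<open>The interval must contain \<open>c\<close>, which may lie on either side of
    \<open>x\<close>, and have \<open>x\<close> in its interior, so that the derivative within it is
    the full derivative.\<close>
  define a where "a = min c (x - e)"
  define b where "b = max c (x + e)"
  have "a \<in> ivl l r" "b \<in> ivl l r"
    using xe c by (auto simp: a_def b_def min_def max_def)
  then have ab: "{a..b} \<subseteq> ivl l r" "a \<le> c" "c \<le> b" "a < x" "x < b"
    using e(1) Icc_subset_ivl by (auto simp: a_def b_def)
  have "((\<lambda>u. LBINT y=ereal c..ereal u. h y) has_vector_derivative h x) (at x within {a..b})"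
    by (rule interval_integral_FTC2) (use ab in \<open>auto intro: continuous_on_subset[OF h]\<close>)
  moreover have "at x within {a..b} = at x"
    using ab by (intro at_within_interior) auto
  ultimately show ?thesis by (simp add: has_real_derivative_iff_has_vector_derivative)
qed

text \<open>
The martingale problem only admits test functions that are twice continuously differentiable on the
whole line, while the functions of interest live on the state interval.
\<close>

lemma C2_extension:
  fixes w w1 w2 :: "real \<Rightarrow> real"
  assumes ab: "a < b"
    and w: "\<And>x. x \<in> {a..b} \<Longrightarrow> (w has_real_derivative w1 x) (at x)"
    and w1: "\<And>x. x \<in> {a..b} \<Longrightarrow> (w1 has_real_derivative w2 x) (at x)"
    and w2: "continuous_on {a..b} w2"
  obtains \<phi> \<phi>' \<phi>'' where
    "\<forall>x. (\<phi> has_real_derivative \<phi>' x) (at x)" "\<forall>x. (\<phi>' has_real_derivative \<phi>'' x) (at x)"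
    "continuous_on UNIV \<phi>''"
    "\<And>x. x \<in> {a..b} \<Longrightarrow> \<phi> x = w x \<and> \<phi>' x = w1 x \<and> \<phi>'' x = w2 x"
proof -
  have ad: "\<exists>F. \<forall>x. (F has_real_derivative f x) (at x) \<and> F a = y" if f: "continuous_on UNIV f" for f :: "real \<Rightarrow> real" and y
  proof -
    have "\<exists>F. \<forall>x :: real. -\<infinity> < ereal x \<longrightarrow> ereal x < \<infinity> \<longrightarrow> (F has_vector_derivative f x) (at x)"
      by (rule einterval_antiderivative) (use f in \<open>auto simp: continuous_on_eq_continuous_at\<close>)
    then obtain F where F: "\<And>x. (F has_real_derivative f x) (at x)"
      by (auto simp: has_real_derivative_iff_has_vector_derivative)
    then show ?thesis by (intro exI[of _ "\<lambda>x. F x - F a + y"]) (auto intro!: derivative_eq_intros)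
  qed
  have uniq: "F x = G x" if "F a = G a" "x \<in> {a..b}"
    "\<And>x. x \<in> {a..b} \<Longrightarrow> (F has_real_derivative f x) (at x)"
    "\<And>x. x \<in> {a..b} \<Longrightarrow> (G has_real_derivative f x) (at x)" for F G f x
  proof -
    have d: "((\<lambda>x. F x - G x) has_real_derivative 0) (at x)" if "x \<in> {a..b}" for x
      using \<open>\<And>x. x \<in> {a..b} \<Longrightarrow> (F has_real_derivative f x) (at x)\<close>[OF that]
        \<open>\<And>x. x \<in> {a..b} \<Longrightarrow> (G has_real_derivative f x) (at x)\<close>[OF that]
      by (auto intro!: derivative_eq_intros)
    have "F x - G x = F a - G a"
      by (rule DERIV_isconst2[OF ab])
        (use d that(2) in \<open>auto intro!: continuous_at_imp_continuous_on DERIV_isCont[OF d]\<close>)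
    then show ?thesis using that(1) by simp
  qed
  \<comment> \<open>Continues \<open>w2\<close> by its end values, which keeps it continuous.
    Integrating twice from \<open>a\<close> with initial values \<open>w1 a\<close> and
    \<open>w a\<close> then reproduces \<open>w1\<close> and \<open>w\<close> on
    \<open>[a, b]\<close>.\<close>
  define \<phi>'' where "\<phi>'' x = w2 (max a (min b x))" for x
  have c: "continuous_on UNIV \<phi>''"
    unfolding \<phi>''_def using ab
    by (intro continuous_on_compose2[OF w2]) (auto intro!: continuous_intros)
  obtain \<phi>' where d1: "\<forall>x. (\<phi>' has_real_derivative \<phi>'' x) (at x)" "\<phi>' a = w1 a"
    using ad[OF c, of "w1 a"] by auto
  have "continuous_on UNIV \<phi>'" using d1(1) by (intro continuous_at_imp_continuous_on) (auto intro: DERIV_isCont)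
  then obtain \<phi> where d: "\<forall>x. (\<phi> has_real_derivative \<phi>' x) (at x)" "\<phi> a = w a"
    using ad[of \<phi>' "w a"] by auto
  have e2: "\<phi>'' x = w2 x" if "x \<in> {a..b}" for x using that by (auto simp: \<phi>''_def)
  have e1: "\<phi>' x = w1 x" if "x \<in> {a..b}" for x
  proof (rule uniq[where f = w2 and F = \<phi>' and G = w1, OF d1(2) that _ w1])
    show "(\<phi>' has_real_derivative w2 y) (at y)" if "y \<in> {a..b}" for y
      using d1(1) e2[OF that] by metis
  qed
  have e0: "\<phi> x = w x" if "x \<in> {a..b}" for x
  proof (rule uniq[where f = w1 and F = \<phi> and G = w, OF d(2) that _ w])
    show "(\<phi> has_real_derivative w1 y) (at y)" if "y \<in> {a..b}" for y
      using d(1) e1[OF that] by metis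
  qed
  show thesis using that[OF d(1) d1(1) c] e0 e1 e2 by blast
qed

section \<open>The solution of the generator equation\<close>

lemma eventually_at_left_eD:
  assumes "eventually P (at_left_e z)" "ereal a < z"
  obtains t0 where "a \<le> t0" "ereal t0 < z" "\<And>t. t0 < t \<Longrightarrow> ereal t < z \<Longrightarrow> P t"
proof (cases z)
  case (real z')
  then obtain b where b: "b < z'" "\<And>t. b < t \<Longrightarrow> t < z' \<Longrightarrow> P t"
    using assms(1) by (auto simp: at_left_e_def eventually_at_left_field)
  show ?thesis by (rule that[of "max a b"]) (use b assms(2) real in auto)
next
  case PInf
  then obtain b where b: "\<And>t. b < t \<Longrightarrow> P t"
    using assms(1) by (auto simp: at_left_e_def eventually_at_top_dense)
  show ?thesis by (rule that[of "max a b"]) (use b PInf in \<open>auto simp: max_def split: if_splits\<close>)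
qed (use assms in auto)

lemma eventually_at_right_eD:
  assumes "eventually P (at_right_e z)" "z < ereal a"
  obtains t0 where "t0 \<le> a" "z < ereal t0" "\<And>t. t < t0 \<Longrightarrow> z < ereal t \<Longrightarrow> P t"
proof (cases z)
  case (real z')
  then obtain b where b: "z' < b" "\<And>t. z' < t \<Longrightarrow> t < b \<Longrightarrow> P t"
    using assms(1) by (auto simp: at_right_e_def eventually_at_right_field)
  show ?thesis by (rule that[of "min a b"]) (use b assms(2) real in auto)
next
  case MInf
  then obtain b where b: "\<And>t. t < b \<Longrightarrow> P t"
    using assms(1) by (auto simp: at_right_e_def eventually_at_bot_dense)
  show ?thesis by (rule that[of "min a b"]) (use b MInf in \<open>auto simp: min_def split: if_splits\<close>)
qed (use assms in auto)

locale diffusion_coefficients =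
  fixes l r :: ereal and \<sigma> b f :: "real \<Rightarrow> real" and c :: real
  assumes cont_sigma: "continuous_on (ivl l r) \<sigma>"
    and cont_b: "continuous_on (ivl l r) b"
    and cont_f: "continuous_on (ivl l r) f"
    and sigma_pos: "\<And>x. x \<in> ivl l r \<Longrightarrow> 0 < \<sigma> x"
    and f_pos: "\<And>x. x \<in> ivl l r \<Longrightarrow> 0 < f x"
    and c: "c \<in> ivl l r"
begin

definition scale_density :: "real \<Rightarrow> real" where
  "scale_density x = exp (- BY \<sigma> b c x)"

definition speed_f :: "real \<Rightarrow> real" where
  "speed_f x = f x * (2 / (\<sigma> x)\<^sup>2 * exp (BY \<sigma> b c x))"

text \<open>Multiplied by \<open>2 exp B / \<sigma>^2\<close>, the generator equation reads
  \<open>(exp B * w')' = speed_f\<close>; \<open>Q\<close> is the resulting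
  \<open>exp B * w'\<close> with value 0 at \<open>c\<close>.\<close>

definition Q :: "real \<Rightarrow> real" where
  "Q x = (LBINT v=ereal c..ereal x. speed_f v)"

definition w :: "real \<Rightarrow> real" where
  "w x = (LBINT v=ereal c..ereal x. scale_density v * Q v)"

definition w1 :: "real \<Rightarrow> real" where
  "w1 x = scale_density x * Q x"

text \<open>Solved from the generator equation, which therefore holds by construction; that this is
  the derivative of \<open>w1\<close> is what needs a proof.\<close>

definition w2 :: "real \<Rightarrow> real" where
  "w2 x = 2 / (\<sigma> x)\<^sup>2 * (f x - b x * w1 x)"

lemma ne: "x \<in> ivl l r \<Longrightarrow> \<sigma> x \<noteq> 0"
  using sigma_pos by force

lemma BY_deriv: "x \<in> ivl l r \<Longrightarrow> (BY \<sigma> b c has_real_derivative 2 * (b x / (\<sigma> x)\<^sup>2)) (at x)"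
  unfolding BY_def
  by (intro DERIV_cmult LBINT_has_derivative[where l = l and r = r] c continuous_intros cont_b cont_sigma) (use ne in auto)

lemma cont_BY: "continuous_on (ivl l r) (BY \<sigma> b c)"
  by (intro continuous_at_imp_continuous_on ballI DERIV_isCont[OF BY_deriv])

lemma cont_scale: "continuous_on (ivl l r) scale_density"
  unfolding scale_density_def by (intro continuous_intros cont_BY)

lemma cont_speed: "continuous_on (ivl l r) speed_f"
  unfolding speed_f_def by (intro continuous_intros cont_BY cont_f cont_sigma) (use ne in auto)

lemma speed_pos: "x \<in> ivl l r \<Longrightarrow> 0 < speed_f x"
  using f_pos[of x] sigma_pos[of x] by (simp add: speed_f_def)

lemma scale_pos: "0 < scale_density x"
  by (simp add: scale_density_def)

lemma scale_deriv:
  "x \<in> ivl l r \<Longrightarrow> (scale_density has_real_derivative - (2 * (b x / (\<sigma> x)\<^sup>2)) * scale_density x) (at x)"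
  unfolding scale_density_def by (auto intro!: derivative_eq_intros BY_deriv)

lemma Q_deriv: "x \<in> ivl l r \<Longrightarrow> (Q has_real_derivative speed_f x) (at x)"
  unfolding Q_def by (intro LBINT_has_derivative[where l = l and r = r] cont_speed c)

lemma cont_Q: "continuous_on (ivl l r) Q"
  by (intro continuous_at_imp_continuous_on ballI DERIV_isCont[OF Q_deriv])

lemma cont_w1: "continuous_on (ivl l r) w1"
  unfolding w1_def by (intro continuous_intros cont_Q cont_scale)

lemma w_deriv: "x \<in> ivl l r \<Longrightarrow> (w has_real_derivative w1 x) (at x)"
  unfolding w_def w1_def by (intro LBINT_has_derivative[where l = l and r = r] continuous_intros cont_Q cont_scale c)

text \<open>The exponential in the scale density cancels the one in \<open>speed_f\<close>, and the
  logarithmic derivative of the scale density supplies the drift term.\<close>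

lemma w1_deriv:
  assumes x: "x \<in> ivl l r" shows "(w1 has_real_derivative w2 x) (at x)"
proof -
  have "(w1 has_real_derivative - (2 * (b x / (\<sigma> x)\<^sup>2)) * scale_density x * Q x + speed_f x * scale_density x) (at x)"
    unfolding w1_def by (rule DERIV_mult[OF scale_deriv[OF x] Q_deriv[OF x]])
  moreover have "speed_f x * scale_density x = 2 / (\<sigma> x)\<^sup>2 * f x"
    by (simp add: speed_f_def scale_density_def exp_minus)
  ultimately show ?thesis by (simp add: w2_def w1_def algebra_simps)
qed

lemma cont_w: "continuous_on (ivl l r) w"
  by (intro continuous_at_imp_continuous_on ballI DERIV_isCont[OF w_deriv])

lemma cont_w2: "continuous_on (ivl l r) w2"
  unfolding w2_def by (intro continuous_intros cont_w1 cont_f cont_b cont_sigma) (use ne in auto)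

lemma generator_w: "x \<in> ivl l r \<Longrightarrow> (\<sigma> x)\<^sup>2 * w2 x / 2 + b x * w1 x = f x"
  using ne[of x] by (simp add: w2_def field_simps)

lemma Q_c: "Q c = 0" and w_c: "w c = 0"
  by (simp_all add: Q_def w_def)

lemma Q_mono:
  assumes "x \<in> ivl l r" "y \<in> ivl l r" "x \<le> y" shows "Q x \<le> Q y"
  by (rule DERIV_nonneg_imp_nondecreasing[OF assms(3)])
    (use Icc_subset_ivl[OF assms(1,2)] Q_deriv speed_pos in \<open>force intro: less_imp_le\<close>)

lemma w_mono:
  assumes "c \<le> x" "x \<le> y" "y \<in> ivl l r" shows "w x \<le> w y"
proof (rule DERIV_nonneg_imp_nondecreasing[OF assms(2)])
  fix z assume z: "x \<le> z" "z \<le> y"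
  then have zI: "z \<in> ivl l r" using Icc_subset_ivl[OF c assms(3)] assms(1) by auto
  have "0 \<le> w1 z" using Q_mono[OF c zI] z assms(1) scale_pos[of z] by (simp add: w1_def Q_c)
  then show "\<exists>d. (w has_real_derivative d) (at z) \<and> 0 \<le> d" using w_deriv[OF zI] by blast
qed

text \<open>\<open>w\<close> has its minimum 0 at \<open>c\<close>, because \<open>w1\<close>
  changes sign there together with \<open>Q\<close>. The part to the left of \<open>c\<close>
  matters since the path may start there; the sign allows \<open>w (Y 0)\<close> to be dropped when
  the additive functional is bounded.\<close>

lemma w_nonneg:
  assumes x: "x \<in> ivl l r" shows "0 \<le> w x"
proof (cases "c \<le> x")
  case True
  then show ?thesis using w_mono[of c x] x by (simp add: w_c)
next
  case False
  have "w c \<le> w x"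
  proof (rule DERIV_nonpos_imp_nonincreasing[of x c w])
    show "x \<le> c" using False by simp
    fix z assume z: "x \<le> z" "z \<le> c"
    then have zI: "z \<in> ivl l r" using Icc_subset_ivl[OF x c] by auto
    have "w1 z \<le> 0" using Q_mono[OF zI c] z scale_pos[of z] by (simp add: w1_def Q_c mult_nonneg_nonpos)
    then show "\<exists>d. (w has_real_derivative d) (at z) \<and> d \<le> 0" using w_deriv[OF zI] by blast
  qed
  then show ?thesis by (simp add: w_c)
qed

end

section \<open>Paths and stopped martingales\<close>

text \<open>The times up to \<open>t0\<close> at which the path is outside the open interval form a
  compact set, so there is a first one. The closed interval is claimed only for
  \<open>0 < T\<close>: a path that starts outside has \<open>T = 0\<close> and may be
  anywhere.\<close>

lemma exit_time_attained:
  assumes cont: "continuous_on {t. 0 \<le> t \<and> ereal t < \<zeta> \<omega>} (\<lambda>t. Y t \<omega>)"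
    and t0: "0 \<le> t0" "ereal t0 < \<zeta> \<omega>" "Y t0 \<omega> \<notin> {a<..<b}"
  obtains T where "exit_time Y \<zeta> a b \<omega> = ereal T" "0 \<le> T" "ereal T < \<zeta> \<omega>" "Y T \<omega> \<notin> {a<..<b}"
    "\<And>s. 0 \<le> s \<Longrightarrow> s < T \<Longrightarrow> Y s \<omega> \<in> {a<..<b}"
    "\<And>s. 0 < T \<Longrightarrow> 0 \<le> s \<Longrightarrow> s \<le> T \<Longrightarrow> Y s \<omega> \<in> {a..b}"
proof -
  have sub: "{0..t} \<subseteq> {t. 0 \<le> t \<and> ereal t < \<zeta> \<omega>}" if "ereal t < \<zeta> \<omega>" for t
    using that by (auto intro: le_less_trans[of _ "ereal t"])
  define S where "S = {0..t0} \<inter> (\<lambda>t. Y t \<omega>) -` (- {a<..<b})"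
  have "closed S" unfolding S_def
    by (intro continuous_closed_preimage continuous_on_subset[OF cont sub[OF t0(2)]]) (auto intro: closed_Compl)
  moreover have "t0 \<in> S" "bdd_below S" using t0 by (auto simp: S_def intro: bdd_below_mono[of "{0..t0}"])
  ultimately have TS: "Inf S \<in> S" by (intro closed_contains_Inf) auto
  define T where "T = Inf S"
  have T: "0 \<le> T" "T \<le> t0" "Y T \<omega> \<notin> {a<..<b}" using TS by (auto simp: S_def T_def)
  have lb: "T \<le> t" if "t \<in> S" for t using that \<open>bdd_below S\<close> unfolding T_def by (rule cInf_lower)
  have Tz: "ereal T < \<zeta> \<omega>" using T(2) t0(2) by (auto intro: le_less_trans[of _ "ereal t0"])
  have in_: "Y s \<omega> \<in> {a<..<b}" if "0 \<le> s" "s < T" for s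
    using lb[of s] that T(2) by (auto simp: S_def)
  have "Inf (ereal ` {t. 0 \<le> t \<and> ereal t < \<zeta> \<omega> \<and> Y t \<omega> \<notin> {a<..<b}}) = ereal T"
  proof (rule antisym)
    show "Inf (ereal ` {t. 0 \<le> t \<and> ereal t < \<zeta> \<omega> \<and> Y t \<omega> \<notin> {a<..<b}}) \<le> ereal T"
      using T Tz by (intro Inf_lower) auto
    show "ereal T \<le> Inf (ereal ` {t. 0 \<le> t \<and> ereal t < \<zeta> \<omega> \<and> Y t \<omega> \<notin> {a<..<b}})"
      using in_ by (intro Inf_greatest) (force simp: not_less[symmetric])
  qed
  then have ex: "exit_time Y \<zeta> a b \<omega> = ereal T"
    unfolding exit_time_def using Tz by (simp add: min_absorb2)
  \<comment> \<open>Containment before \<open>T\<close> passes to \<open>T\<close> by closure;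
    \<open>0 < T\<close> makes \<open>T\<close> a limit of earlier times.\<close>
  have cl: "Y s \<omega> \<in> {a..b}" if "0 < T" "0 \<le> s" "s \<le> T" for s
  proof -
    have "(\<lambda>t. Y t \<omega>) ` closure {0..<T} \<subseteq> {a..b}"
      using that(1) in_ by (intro image_closure_subset continuous_on_subset[OF cont])
        (use sub[OF Tz] in \<open>force intro: less_imp_le\<close>)+
    then show ?thesis using that by (auto simp: image_subset_iff)
  qed
  show thesis by (rule that[OF ex T(1) Tz T(3) in_ cl])
qed

definition additive_path :: "(real \<Rightarrow> real) \<Rightarrow> (real \<Rightarrow> 'a \<Rightarrow> real) \<Rightarrow> 'a \<Rightarrow> real \<Rightarrow> real" where
  "additive_path f Y \<omega> t = (LINT s:{0..t}|lborel. f (Y s \<omega>))"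

locale diffusion_process = diffusion_coefficients l r \<sigma> b f c
  for l r :: ereal and \<sigma> b f :: "real \<Rightarrow> real" and c :: real +
  fixes M :: "'a measure" and F :: "real \<Rightarrow> 'a measure"
    and Y :: "real \<Rightarrow> 'a \<Rightarrow> real" and \<zeta> :: "'a \<Rightarrow> ereal"
  assumes diff: "diffusion M F Y \<zeta> l r \<sigma> b"
    and Ylim: "AE \<omega> in M. ((\<lambda>t. ereal (Y t \<omega>)) \<longlongrightarrow> r) (at_left_e (\<zeta> \<omega>))"
begin

abbreviation A where "A \<equiv> additive_path f Y"

definition N where "N \<omega> t = w (Y t \<omega>) - w (Y 0 \<omega>) - A \<omega> t"

lemma prob: "prob_space M" and filt: "filtration (space M) F" and FM: "\<forall>t. sets (F t) \<subseteq> sets M"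
  using diff unfolding diffusion_def by blast+

lemma path:
  assumes "\<omega> \<in> space M"
  shows "0 < \<zeta> \<omega>" "continuous_on {t. 0 \<le> t \<and> ereal t < \<zeta> \<omega>} (\<lambda>t. Y t \<omega>)"
    "\<And>t. 0 \<le> t \<Longrightarrow> ereal t < \<zeta> \<omega> \<Longrightarrow> Y t \<omega> \<in> ivl l r"
  using assms diff unfolding diffusion_def by blast+

lemma Icc_lifetime: "ereal t < \<zeta> \<omega> \<Longrightarrow> {0..t} \<subseteq> {t. 0 \<le> t \<and> ereal t < \<zeta> \<omega>}"
  by (auto intro: le_less_trans[of _ "ereal t"])

lemma cont_comp:
  assumes "\<omega> \<in> space M" "continuous_on (ivl l r) h"
  shows "continuous_on {t. 0 \<le> t \<and> ereal t < \<zeta> \<omega>} (\<lambda>t. h (Y t \<omega>))"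
  by (rule continuous_on_compose2[OF assms(2) path(2)[OF assms(1)]]) (use path(3)[OF assms(1)] in auto)

lemma A_mono:
  assumes "\<omega> \<in> space M" "0 \<le> s" "s \<le> t" "ereal t < \<zeta> \<omega>"
  shows "A \<omega> s \<le> A \<omega> t"
proof -
  have int: "set_integrable lborel {0..u} (\<lambda>s. f (Y s \<omega>))" if "u \<le> t" for u
    using that assms(4) by (intro borel_integrable_atLeastAtMost' continuous_on_subset[OF cont_comp[OF assms(1) cont_f]]
        Icc_lifetime) (auto intro: le_less_trans[of _ "ereal t"])
  have "0 \<le> f (Y x \<omega>)" if "x \<in> {0..t}" for x
    using path(3)[OF assms(1), of x] f_pos[of "Y x \<omega>"] Icc_lifetime[OF assms(4)] that by auto
  then show ?thesis unfolding additive_path_def set_lebesgue_integral_def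
    using int[OF assms(3)] int[OF order_refl] assms(3) unfolding set_integrable_def
    by (intro integral_mono) (auto simp: indicator_def)
qed

lemma A_0: "A \<omega> 0 = 0"
  unfolding additive_path_def set_lebesgue_integral_def
  by (rule integral_eq_zero_AE) (auto intro: eventually_mono[OF AE_lborel_singleton[of 0]])

lemma A_nonneg: "\<omega> \<in> space M \<Longrightarrow> 0 \<le> t \<Longrightarrow> ereal t < \<zeta> \<omega> \<Longrightarrow> 0 \<le> A \<omega> t"
  using A_mono[of \<omega> 0 t] by (simp add: A_0)

lemma N_0: "N \<omega> 0 = 0"
  by (simp add: N_def A_0)

lemma cont_N:
  assumes "\<omega> \<in> space M" "ereal t < \<zeta> \<omega>"
  shows "continuous_on {0..t} (N \<omega>)"
proof -
  have cf: "continuous_on {0..t} (\<lambda>s. f (Y s \<omega>))"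
    by (rule continuous_on_subset[OF cont_comp[OF assms(1) cont_f] Icc_lifetime[OF assms(2)]])
  \<comment> \<open>For this continuous integrand the Lebesgue integral equals the gauge integral,
    whose primitive is continuous.\<close>
  have "continuous_on {0..t} (\<lambda>s. integral {0..s} (\<lambda>s. f (Y s \<omega>)))"
    by (intro indefinite_integral_continuous_1 integrable_continuous_real cf)
  moreover have "A \<omega> s = integral {0..s} (\<lambda>s. f (Y s \<omega>))" if "s \<in> {0..t}" for s
    unfolding additive_path_def using that
    by (intro set_borel_integral_eq_integral borel_integrable_atLeastAtMost' continuous_on_subset[OF cf]) auto
  ultimately have "continuous_on {0..t} (A \<omega>)" by (subst continuous_on_cong[OF refl]) auto
  then show ?thesis unfolding N_def
    by (intro continuous_intros continuous_on_subset[OF cont_comp[OF assms(1) cont_w] Icc_lifetime[OF assms(2)]])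
qed

text \<open>Packages a first exit strictly before the lifetime, so that later estimates need not
  inspect \<open>exit_time\<close>, whose default is the lifetime.\<close>

definition exits where
  "exits a b' \<omega> T \<longleftrightarrow> exit_time Y \<zeta> a b' \<omega> = ereal T \<and> 0 \<le> T \<and> ereal T < \<zeta> \<omega> \<and> Y T \<omega> \<notin> {a<..<b'} \<and>
    (\<forall>s. 0 \<le> s \<longrightarrow> s < T \<longrightarrow> Y s \<omega> \<in> {a<..<b'}) \<and> (0 < T \<longrightarrow> (\<forall>s. 0 \<le> s \<longrightarrow> s \<le> T \<longrightarrow> Y s \<omega> \<in> {a..b'}))"

lemma limit_eventually:
  assumes "((\<lambda>t. ereal (Y t \<omega>)) \<longlongrightarrow> r) (at_left_e (\<zeta> \<omega>))" "ereal x < r" "\<omega> \<in> space M"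
  obtains t0 where "0 \<le> t0" "ereal t0 < \<zeta> \<omega>" "\<And>t. t0 \<le> t \<Longrightarrow> ereal t < \<zeta> \<omega> \<Longrightarrow> x < Y t \<omega>"
proof -
  have "eventually (\<lambda>t. ereal x < ereal (Y t \<omega>)) (at_left_e (\<zeta> \<omega>))"
    by (rule order_tendstoD(1)[OF assms(1,2)])
  moreover have "ereal 0 < \<zeta> \<omega>" using path(1)[OF assms(3)] by (simp add: zero_ereal_def)
  ultimately obtain t0 where t0: "0 \<le> t0" "ereal t0 < \<zeta> \<omega>" "\<And>t. t0 < t \<Longrightarrow> ereal t < \<zeta> \<omega> \<Longrightarrow> ereal x < ereal (Y t \<omega>)"
    by (rule eventually_at_left_eD) blast
  \<comment> \<open>A strictly later time turns the strict \<open>t0 < t\<close> of the filter into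
    \<open>t1 \<le> t\<close>.\<close>
  obtain t1 where t1: "ereal t0 < ereal t1" "ereal t1 < \<zeta> \<omega>" using ereal_dense2[OF t0(2)] by auto
  show ?thesis by (rule that[of t1]) (use t0 t1 in auto)
qed

text \<open>A path that tends to \<open>r\<close> is finally above \<open>b' < r\<close>, hence
  outside the interval.\<close>

lemma ex_exits:
  assumes "((\<lambda>t. ereal (Y t \<omega>)) \<longlongrightarrow> r) (at_left_e (\<zeta> \<omega>))" "ereal b' < r" "\<omega> \<in> space M"
  obtains T where "exits a b' \<omega> T"
proof -
  obtain t0 where "0 \<le> t0" "ereal t0 < \<zeta> \<omega>" "\<And>t. t0 \<le> t \<Longrightarrow> ereal t < \<zeta> \<omega> \<Longrightarrow> b' < Y t \<omega>"
    using limit_eventually[OF assms] by blast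
  then have t0: "0 \<le> t0" "ereal t0 < \<zeta> \<omega>" "Y t0 \<omega> \<notin> {a<..<b'}" by force+
  show thesis
    by (rule exit_time_attained[where \<zeta> = \<zeta> and Y = Y and \<omega> = \<omega> and a = a and b = b', OF path(2)[OF assms(3)] t0])
      (rule that, auto simp: exits_def)
qed

text \<open>
The identity is restricted to paths that leave (a,b') before the lifetime, because otherwise the
martingale may involve the arbitrary value of Y at the lifetime; by the limit assumption almost
every path leaves.
\<close>

lemma stopped_martingale:
  assumes ab: "a < b'" "{a..b'} \<subseteq> ivl l r"
  obtains X where "martingale M F X"
    "\<And>\<omega> T t. \<omega> \<in> space M \<Longrightarrow> exits a b' \<omega> T \<Longrightarrow> 0 \<le> t \<Longrightarrow> X t \<omega> = N \<omega> (min t T)"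
proof -
  have cw2: "continuous_on {a..b'} w2" by (rule continuous_on_subset[OF cont_w2 ab(2)])
  obtain \<phi> \<phi>' \<phi>'' where \<phi>: "\<forall>x. (\<phi> has_real_derivative \<phi>' x) (at x)" "\<forall>x. (\<phi>' has_real_derivative \<phi>'' x) (at x)"
    "continuous_on UNIV \<phi>''"
    and eq: "\<And>x. x \<in> {a..b'} \<Longrightarrow> \<phi> x = w x \<and> \<phi>' x = w1 x \<and> \<phi>'' x = w2 x"
    by (rule C2_extension[OF ab(1) w_deriv w1_deriv cw2]) (use ab(2) in blast)+
  \<comment> \<open>The process of the martingale problem verbatim, so that the hypothesis can be
    instantiated; its identification with \<open>N\<close> comes afterwards.\<close>
  define X where "X t \<omega> = (let u = real_of_ereal (min (ereal t) (exit_time Y \<zeta> a b' \<omega>)) in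
          \<phi> (Y u \<omega>) - \<phi> (Y 0 \<omega>) -
          (LINT s:{0..u}|lborel. (\<sigma> (Y s \<omega>))\<^sup>2 * \<phi>'' (Y s \<omega>) / 2 + b (Y s \<omega>) * \<phi>' (Y s \<omega>)))" for t \<omega>
  have mart: "martingale M F X"
    using diff \<phi> ab(2) unfolding diffusion_def X_def[abs_def] by blast
  have "X t \<omega> = N \<omega> (min t T)" if "\<omega> \<in> space M" and T: "exits a b' \<omega> T" and t: "0 \<le> t" for \<omega> T t
  proof -
    have u: "real_of_ereal (min (ereal t) (exit_time Y \<zeta> a b' \<omega>)) = min t T"
      using T by (simp add: exits_def ereal_min[symmetric] del: ereal_min)
    show ?thesis
    \<comment> \<open>A path that starts outside \<open>(a, b')\<close> is stopped at once. There
      \<open>\<phi>\<close> need not agree with \<open>w\<close>, but both processes are 0.\<close>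
    proof (cases "T = 0")
      case True
      have "(LINT s:{0..0}|lborel. h s) = 0" for h :: "real \<Rightarrow> real"
        unfolding set_lebesgue_integral_def
        by (rule integral_eq_zero_AE) (auto intro: eventually_mono[OF AE_lborel_singleton[of 0]])
      with True show ?thesis using t unfolding X_def u by (simp add: N_0)
    next
      case False
      then have Yin: "Y s \<omega> \<in> {a..b'}" if "0 \<le> s" "s \<le> T" for s using T that by (auto simp: exits_def)
      have "(LINT s:{0..min t T}|lborel. (\<sigma> (Y s \<omega>))\<^sup>2 * \<phi>'' (Y s \<omega>) / 2 + b (Y s \<omega>) * \<phi>' (Y s \<omega>)) = A \<omega> (min t T)"
        unfolding additive_path_def
      proof (intro set_lebesgue_integral_cong allI impI)
        fix s assume "s \<in> {0..min t T}"
        then have "Y s \<omega> \<in> {a..b'}" by (intro Yin) auto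
        then show "(\<sigma> (Y s \<omega>))\<^sup>2 * \<phi>'' (Y s \<omega>) / 2 + b (Y s \<omega>) * \<phi>' (Y s \<omega>) = f (Y s \<omega>)"
          using generator_w[of "Y s \<omega>"] eq[of "Y s \<omega>"] ab(2) by auto
      qed auto
      then show ?thesis
        using T t Yin[of "min t T"] Yin[of 0] eq
        unfolding X_def u Let_def N_def by (simp add: exits_def)
    qed
  qed
  with mart show thesis by (rule that)
qed

end

section \<open>Finiteness of the additive functional\<close>

context diffusion_process
begin

lemma AE_limit_space:
  "AE \<omega> in M. \<omega> \<in> space M \<and> ((\<lambda>t. ereal (Y t \<omega>)) \<longlongrightarrow> r) (at_left_e (\<zeta> \<omega>))"
  using Ylim AE_space by eventually_elim simp

lemma exits_unbounded:
  assumes \<omega>: "\<omega> \<in> space M" and t: "0 \<le> t" "ereal t < \<zeta> \<omega>"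
    and T: "exits a b' \<omega> T" and in_: "\<And>s. 0 \<le> s \<Longrightarrow> s \<le> t \<Longrightarrow> Y s \<omega> \<in> {a<..<b'}"
  shows "t < T"
  using T in_[of T] unfolding exits_def by (meson not_less)

lemma path_range:
  assumes \<omega>: "\<omega> \<in> space M" and t: "0 \<le> t" "ereal t < \<zeta> \<omega>"
  obtains y1 y2 where "y1 \<in> ivl l r" "y2 \<in> ivl l r" "\<And>s. 0 \<le> s \<Longrightarrow> s \<le> t \<Longrightarrow> y1 \<le> Y s \<omega> \<and> Y s \<omega> \<le> y2"
proof -
  have c: "continuous_on {0..t} (\<lambda>s. Y s \<omega>)"
    by (rule continuous_on_subset[OF path(2)[OF \<omega>] Icc_lifetime[OF t(2)]])
  have ne: "{0..t} \<noteq> {}" using t by auto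
  obtain s1 where s1: "s1 \<in> {0..t}" "\<And>s. s \<in> {0..t} \<Longrightarrow> Y s1 \<omega> \<le> Y s \<omega>"
    using continuous_attains_inf[OF compact_Icc ne c] by auto
  obtain s2 where s2: "s2 \<in> {0..t}" "\<And>s. s \<in> {0..t} \<Longrightarrow> Y s \<omega> \<le> Y s2 \<omega>"
    using continuous_attains_sup[OF compact_Icc ne c] by auto
  show ?thesis
    by (rule that[of "Y s1 \<omega>" "Y s2 \<omega>"])
      (use s1 s2 path(3)[OF \<omega>] Icc_lifetime[OF t(2)] in auto)
qed

text \<open>Supplies a bound free of \<open>\<omega>\<close>, as dominated convergence over the
  grids requires.\<close>

lemma N_bounded:
  assumes ab: "{a..b'} \<subseteq> ivl l r"
  obtains C where "\<And>\<omega> T u. \<omega> \<in> space M \<Longrightarrow> exits a b' \<omega> T \<Longrightarrow> 0 \<le> u \<Longrightarrow> u \<le> T \<Longrightarrow> u \<le> t \<Longrightarrow> \<bar>N \<omega> u\<bar> \<le> C"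
proof -
  have "bounded (w ` {a..b'})" "bounded (f ` {a..b'})"
    using continuous_on_subset[OF cont_w ab] continuous_on_subset[OF cont_f ab]
    by (auto intro!: compact_imp_bounded compact_continuous_image)
  then obtain B1 B2 where B: "0 < B1" "0 < B2" "\<And>x. x \<in> {a..b'} \<Longrightarrow> \<bar>w x\<bar> \<le> B1" "\<And>x. x \<in> {a..b'} \<Longrightarrow> \<bar>f x\<bar> \<le> B2"
    unfolding bounded_pos by auto
  show thesis
  \<comment> \<open>Two values of \<open>w\<close>, and an additive functional that gathers at most
    \<open>B2\<close> per unit of time. At \<open>u = 0\<close> the path may lie outside the
    interval, but \<open>N\<close> is 0 there.\<close>
  proof (rule that[of "2 * B1 + \<bar>t\<bar> * B2"])
    fix \<omega> T u assume *: "\<omega> \<in> space M" "exits a b' \<omega> T" "0 \<le> u" "u \<le> T" "u \<le> t"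
    show "\<bar>N \<omega> u\<bar> \<le> 2 * B1 + \<bar>t\<bar> * B2"
    proof (cases "u = 0")
      case False
      then have Yin: "Y s \<omega> \<in> {a..b'}" if "0 \<le> s" "s \<le> u" for s using * that by (auto simp: exits_def)
      have uz: "ereal u < \<zeta> \<omega>" using * by (auto simp: exits_def intro: le_less_trans[of _ "ereal T"])
      have "A \<omega> u \<le> (LINT s:{0..u}|lborel. B2)"
        unfolding additive_path_def set_lebesgue_integral_def
      proof (rule integral_mono)
        have "set_integrable lborel {0..u} (\<lambda>s. f (Y s \<omega>))"
          by (intro borel_integrable_atLeastAtMost' continuous_on_subset[OF cont_comp[OF *(1) cont_f]] Icc_lifetime uz)
        then show "integrable lborel (\<lambda>s. indicator {0..u} s *\<^sub>R f (Y s \<omega>))" by (simp add: set_integrable_def)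
        have "set_integrable lborel {0..u} (\<lambda>s. B2)" by (intro borel_integrable_atLeastAtMost' continuous_intros)
        then show "integrable lborel (\<lambda>s. indicator {0..u} s *\<^sub>R B2)" by (simp add: set_integrable_def)
        show "indicator {0..u} s *\<^sub>R f (Y s \<omega>) \<le> indicator {0..u} s *\<^sub>R B2" for s
          using Yin[of s] B(4)[of "Y s \<omega>"] by (auto simp: indicator_def)
      qed
      also have "\<dots> = u * B2" using *(3) by (simp add: set_lebesgue_integral_def)
      also have "\<dots> \<le> \<bar>t\<bar> * B2" using * B by (intro mult_right_mono) auto
      finally have "A \<omega> u \<le> \<bar>t\<bar> * B2" .
      then show ?thesis
        using A_nonneg[OF *(1,3) uz] B(3)[OF Yin[of 0]] B(3)[OF Yin[of u]] *(3) unfolding N_def by auto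
    qed (use B in \<open>simp add: N_0\<close>)
  qed
qed

text \<open>Almost every path exits because \<open>b' < r\<close>, and on such a path continuity and
  boundedness of \<open>X\<close> are those of \<open>N\<close> up to the exit.\<close>

lemma stopped_barrier:
  assumes ab: "a < b'" "{a..b'} \<subseteq> ivl l r" "ereal b' < r"
    and X: "martingale M F X"
      "\<And>\<omega> T t. \<omega> \<in> space M \<Longrightarrow> exits a b' \<omega> T \<Longrightarrow> 0 \<le> t \<Longrightarrow> X t \<omega> = N \<omega> (min t T)"
    and t: "0 < t" and K: "0 < K" and R: "0 < R"
    and D: "D \<in> sets M"
      "\<And>\<omega>. \<omega> \<in> D \<Longrightarrow> R \<le> X t \<omega>"
      "\<And>\<omega> i j. \<omega> \<in> D \<Longrightarrow> i \<le> j \<Longrightarrow> 0 < j \<Longrightarrow> - K < X (t * (real i / real j)) \<omega>"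
  shows "measure M D \<le> K / (R + K)"
proof -
  have ex: "AE \<omega> in M. \<omega> \<in> space M \<and> (\<exists>T. exits a b' \<omega> T)"
    using AE_limit_space by eventually_elim (use ex_exits[OF _ ab(3)] in blast)
  have exD: "0 \<le> T" "ereal T < \<zeta> \<omega>" if "exits a b' \<omega> T" for \<omega> T
    using that by (auto simp: exits_def)
  obtain C where C: "\<And>\<omega> T u. \<omega> \<in> space M \<Longrightarrow> exits a b' \<omega> T \<Longrightarrow> 0 \<le> u \<Longrightarrow> u \<le> T \<Longrightarrow> u \<le> t \<Longrightarrow> \<bar>N \<omega> u\<bar> \<le> C"
    using N_bounded[OF ab(2)] by blast
  show ?thesis
  proof (rule martingale_lower_barrier[OF prob filt FM X(1) _ _ _ t K R D])
    show "AE \<omega> in M. X 0 \<omega> = 0"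
      using ex by eventually_elim (auto simp: X(2) N_0 min_absorb1 exD(1))
    show "AE \<omega> in M. continuous_on {0..t} (\<lambda>s. X s \<omega>)"
      using ex
    proof eventually_elim
      case (elim \<omega>)
      then obtain T where T: "exits a b' \<omega> T" and \<omega>: "\<omega> \<in> space M" by auto
      have "continuous_on {0..t} (\<lambda>s. N \<omega> (min s T))"
        by (rule continuous_on_compose2[OF cont_N[OF \<omega> exD(2)[OF T]]])
          (use exD(1)[OF T] in \<open>auto intro!: continuous_intros\<close>)
      then show ?case by (subst continuous_on_cong[OF refl X(2)[OF \<omega> T]]) auto
    qed
    show "AE \<omega> in M. \<forall>s\<in>{0..t}. \<bar>X s \<omega>\<bar> \<le> C"
      using ex
    proof eventually_elim
      case (elim \<omega>)
      then obtain T where T: "exits a b' \<omega> T" and \<omega>: "\<omega> \<in> space M" by auto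
      show ?case
      proof
        fix s assume "s \<in> {0..t}"
        then show "\<bar>X s \<omega>\<bar> \<le> C"
          unfolding X(2)[OF \<omega> T, of s, simplified] using exD(1)[OF T] X(2)[OF \<omega> T, of s]
          by (auto intro!: C[OF \<omega> T])
      qed
    qed
  qed
qed

lemma additive_functional_finite_iff:
  assumes \<omega>: "\<omega> \<in> space M"
  shows "additive_functional Y \<zeta> f \<omega> < \<infinity> \<longleftrightarrow> (\<exists>C. \<forall>t. 0 \<le> t \<longrightarrow> ereal t < \<zeta> \<omega> \<longrightarrow> A \<omega> t \<le> C)"
  unfolding additive_functional_def additive_path_def
proof (rule nn_integral_Ico_finite_iff)
  show "ereal 0 < \<zeta> \<omega>" using path(1)[OF \<omega>] by (simp add: zero_ereal_def)
  show "continuous_on {x. 0 \<le> x \<and> ereal x < \<zeta> \<omega>} (\<lambda>x. f (Y x \<omega>))" by (rule cont_comp[OF \<omega> cont_f])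
  show "0 \<le> f (Y x \<omega>)" if "0 \<le> x" "ereal x < \<zeta> \<omega>" for x
    using f_pos[OF path(3)[OF \<omega> that]] by simp
qed

lemma finite_imp_bounded:
  assumes fin: "AE \<omega> in M. additive_functional Y \<zeta> f \<omega> < \<infinity>"
  shows "\<exists>C. \<forall>x. c \<le> x \<longrightarrow> ereal x < r \<longrightarrow> w x \<le> C"
proof (rule ccontr)
  assume unb: "\<not> (\<exists>C. \<forall>x. c \<le> x \<longrightarrow> ereal x < r \<longrightarrow> w x \<le> C)"
  interpret prob_space M by (rule prob)
  have lr: "l < r" using c by (auto simp: ivl_iff intro: less_trans)
  obtain u l' where u: "\<And>i. l' i < u i" "\<And>i. l < ereal (l' i)" "\<And>i. ereal (u i) < r"
    "(\<lambda>i. ereal (l' i)) \<longlonglongrightarrow> l" "(\<lambda>i. ereal (u i)) \<longlonglongrightarrow> r"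
    by (rule einterval_Icc_approximation[OF lr]) (rule that)
  have ab: "{l' i..u i} \<subseteq> ivl l r" for i
    using u(1,2,3)[of i] less_trans[of "ereal (l' i)" "ereal (u i)" r] less_trans[of l "ereal (l' i)" "ereal (u i)"]
    by (intro Icc_subset_ivl) (auto simp: ivl_iff)
  have "\<exists>X. martingale M F X \<and> (\<forall>\<omega> T t. \<omega> \<in> space M \<longrightarrow> exits (l' k) (u k) \<omega> T \<longrightarrow> 0 \<le> t \<longrightarrow> X t \<omega> = N \<omega> (min t T))" for k
    using stopped_martingale[OF u(1) ab, of k] by metis
  then obtain X where mart: "\<And>k. martingale M F (X k)"
    and XN: "\<And>k \<omega> T t. \<omega> \<in> space M \<Longrightarrow> exits (l' k) (u k) \<omega> T \<Longrightarrow> 0 \<le> t \<Longrightarrow> X k t \<omega> = N \<omega> (min t T)"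
    by metis
  have Xm: "X k t \<in> borel_measurable M" if "0 \<le> t" for k t
    using mart that unfolding martingale_def by (meson borel_measurable_integrable)
  \<comment> \<open>The path stopped at its exit from the \<open>k\<close>-th interval is at least
    \<open>R\<close> at time \<open>n\<close> and above \<open>-(m + 1)\<close> at all rational
    fractions of \<open>n\<close>. Countably many conditions make this an event, and
    \<open>m + 1\<close> keeps the barrier below 0 even for \<open>m = 0\<close>.\<close>
  define D where "D m R k n = {\<omega> \<in> space M. real R \<le> X k (real n) \<omega> \<and>
      (\<forall>i j. i \<le> j \<longrightarrow> 0 < j \<longrightarrow> - (real m + 1) < X k (real n * (real i / real j)) \<omega>)}" for m R k n :: nat
  have Dm: "D m R k n \<in> events" for m R k n
  proof -
    have [measurable]: "X k (real n) \<in> borel_measurable M"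
      "X k (real n * (real i / real j)) \<in> borel_measurable M" for i j by (auto intro!: Xm)
    show ?thesis unfolding D_def by measurable
  qed
  have "AE \<omega> in M. \<not> (\<exists>m. \<forall>R. \<forall>\<^sub>F k in sequentially. \<forall>\<^sub>F n in sequentially. \<omega> \<in> D m R k n)"
  proof (rule AE_not_eventually[OF Dm])
    fix m R :: nat
    have "prob (D m R k n) \<le> (real m + 1) / (1 + real R)" if n: "0 < n" for k n
    \<comment> \<open>The barrier estimate wants \<open>0 < R\<close>; at \<open>R = 0\<close> the
      claimed bound is at least 1.\<close>
    proof (cases "R = 0")
      case True
      have "prob (D m R k n) \<le> 1" by (rule prob_le_1)
      also have "1 \<le> (real m + 1) / (1 + real R)" using True by simp
      finally show ?thesis .
    next
      case False
      have "prob (D m R k n) \<le> (real m + 1) / (real R + (real m + 1))"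
        by (rule stopped_barrier[OF u(1) ab u(3) mart XN _ _ _ Dm]) (use n False in \<open>auto simp: D_def\<close>)
      also have "\<dots> \<le> (real m + 1) / (1 + real R)" by (intro divide_left_mono) auto
      finally show ?thesis .
    qed
    then show "\<forall>\<^sub>F k in sequentially. \<forall>\<^sub>F n in sequentially. prob (D m R k n) \<le> (real m + 1) / (1 + real R)"
      by (intro always_eventually allI eventually_mono[OF eventually_gt_at_top[of 0]])
  qed
  moreover have "AE \<omega> in M. \<exists>m. \<forall>R. \<forall>\<^sub>F k in sequentially. \<forall>\<^sub>F n in sequentially. \<omega> \<in> D m R k n"
    using AE_limit_space fin
  proof eventually_elim
    case (elim \<omega>)
    then have \<omega>: "\<omega> \<in> space M" and lim: "((\<lambda>t. ereal (Y t \<omega>)) \<longlongrightarrow> r) (at_left_e (\<zeta> \<omega>))" by auto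
    obtain C where C: "\<And>t. 0 \<le> t \<Longrightarrow> ereal t < \<zeta> \<omega> \<Longrightarrow> A \<omega> t \<le> C"
      using elim additive_functional_finite_iff[OF \<omega>] by blast
    \<comment> \<open>As \<open>A\<close> stays below \<open>C\<close>, it suffices that
      \<open>w (Y t)\<close> exceeds \<open>R + w (Y 0) + C\<close>. Unboundedness gives a point
      where \<open>w\<close> does, and monotonicity to the right of \<open>c\<close> preserves this
      once the path stays beyond that point.\<close>
    have Nlarge: "\<exists>t0\<ge>0. ereal t0 < \<zeta> \<omega> \<and> (\<forall>t\<ge>t0. ereal t < \<zeta> \<omega> \<longrightarrow> R \<le> N \<omega> t)" for R
    proof -
      obtain x where x: "c \<le> x" "ereal x < r" "R + w (Y 0 \<omega>) + C < w x"
        using unb by (metis not_le)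
      obtain t0 where t0: "0 \<le> t0" "ereal t0 < \<zeta> \<omega>" "\<And>t. t0 \<le> t \<Longrightarrow> ereal t < \<zeta> \<omega> \<Longrightarrow> x < Y t \<omega>"
        using limit_eventually[OF lim x(2) \<omega>] by blast
      have "R \<le> N \<omega> t" if t: "t0 \<le> t" "ereal t < \<zeta> \<omega>" for t
      proof -
        have "w x \<le> w (Y t \<omega>)" using w_mono[OF x(1)] t0(3)[OF t] path(3)[OF \<omega>, of t] t t0(1) by simp
        then show ?thesis using C[of t] x(3) t t0(1) by (simp add: N_def)
      qed
      then show ?thesis using t0 by blast
    qed
    \<comment> \<open>Compactness bounds \<open>N\<close> on an initial stretch of time; afterwards
      \<open>N\<close> is nonnegative.\<close>
    obtain K :: nat where K: "\<And>t. 0 \<le> t \<Longrightarrow> ereal t < \<zeta> \<omega> \<Longrightarrow> - (real K + 1) < N \<omega> t"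
    proof -
      obtain t0 where t0: "0 \<le> t0" "ereal t0 < \<zeta> \<omega>" "\<And>t. t0 \<le> t \<Longrightarrow> ereal t < \<zeta> \<omega> \<Longrightarrow> 0 \<le> N \<omega> t"
        using Nlarge[of 0] by blast
      have "bounded (N \<omega> ` {0..t0})"
        by (intro compact_imp_bounded compact_continuous_image cont_N[OF \<omega> t0(2)]) auto
      then obtain B where B: "\<And>t. t \<in> {0..t0} \<Longrightarrow> \<bar>N \<omega> t\<bar> \<le> B" unfolding bounded_iff by force
      obtain K :: nat where "B < real K" using reals_Archimedean2 by blast
      then have "- (real K + 1) < N \<omega> t" if "0 \<le> t" "ereal t < \<zeta> \<omega>" for t
        using B[of t] t0(3)[of t] that by (cases "t \<le> t0") auto
      then show thesis by (rule that)
    qed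
    have "\<forall>\<^sub>F k in sequentially. \<forall>\<^sub>F n in sequentially. \<omega> \<in> D K R k n" for R
    proof -
      obtain t0 where t0: "0 \<le> t0" "ereal t0 < \<zeta> \<omega>" "\<And>t. t0 \<le> t \<Longrightarrow> ereal t < \<zeta> \<omega> \<Longrightarrow> real R \<le> N \<omega> t"
        using Nlarge[of "real R"] by blast
      obtain y1 y2 where y: "y1 \<in> ivl l r" "y2 \<in> ivl l r" "\<And>s. 0 \<le> s \<Longrightarrow> s \<le> t0 \<Longrightarrow> y1 \<le> Y s \<omega> \<and> Y s \<omega> \<le> y2"
        using path_range[OF \<omega> t0(1,2)] by blast
      have "\<forall>\<^sub>F k in sequentially. ereal (l' k) < ereal y1"
        using y(1) by (intro order_tendstoD(2)[OF u(4)]) (simp add: ivl_iff)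
      moreover have "\<forall>\<^sub>F k in sequentially. ereal y2 < ereal (u k)"
        using y(2) by (intro order_tendstoD(1)[OF u(5)]) (simp add: ivl_iff)
      ultimately show ?thesis
      proof eventually_elim
        case (elim k)
        obtain T where T: "exits (l' k) (u k) \<omega> T" using ex_exits[OF lim u(3) \<omega>] by blast
        \<comment> \<open>The interval holds the path up to \<open>t0\<close>, so the exit comes
          later, when \<open>N\<close> is already at least \<open>R\<close>. Every \<open>n\<close>
          beyond \<open>T\<close> then sees the value of \<open>N\<close> at the exit.\<close>
        have tT: "t0 < T"
        proof (rule exits_unbounded[OF \<omega> t0(1,2) T])
          fix s assume "0 \<le> s" "s \<le> t0"
          from y(3)[OF this] elim show "Y s \<omega> \<in> {l' k<..<u k}" by auto
        qed
        have T': "0 \<le> T" "ereal T < \<zeta> \<omega>" using T by (auto simp: exits_def)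
        have mz: "ereal (min s T) < \<zeta> \<omega>" for s using T'(2) by (auto simp: min_less_iff_disj)
        obtain n0 :: nat where n0: "T < real n0" using reals_Archimedean2 by blast
        have "\<omega> \<in> D K R k n" if n: "n0 \<le> n" for n
        proof -
          have "real n0 \<le> real n" using n by simp
          then have "X k (real n) \<omega> = N \<omega> T" using n0 XN[OF \<omega> T, of "real n"] by (simp add: min_absorb2)
          moreover have "real R \<le> N \<omega> T" using t0(3)[of T] tT T' by simp
          moreover have "- (real K + 1) < X k (real n * (real i / real j)) \<omega>" for i j
            unfolding XN[OF \<omega> T, of "real n * (real i / real j)", simplified]
            using K[OF _ mz, of "real n * (real i / real j)"] T'(1) XN[OF \<omega> T, of "real n * (real i / real j)"] by simp
          ultimately show ?thesis using \<omega> by (simp add: D_def)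
        qed
        then show ?case unfolding eventually_sequentially by blast
      qed
    qed
    then show ?case by blast
  qed
  ultimately have "AE \<omega> in M. False" by eventually_elim simp
  then show False by (simp add: AE_False)
qed

lemma bounded_imp_finite:
  assumes bdd: "\<exists>C. \<forall>x. c \<le> x \<longrightarrow> ereal x < r \<longrightarrow> w x \<le> C"
  shows "AE \<omega> in M. additive_functional Y \<zeta> f \<omega> < \<infinity>"
proof -
  interpret prob_space M by (rule prob)
  have lr: "l < r" using c by (auto simp: ivl_iff intro: less_trans)
  obtain u l' where u: "\<And>i. l' i < u i" "\<And>i. l < ereal (l' i)" "\<And>i. ereal (u i) < r"
    "(\<lambda>i. ereal (l' i)) \<longlonglongrightarrow> l" "(\<lambda>i. ereal (u i)) \<longlonglongrightarrow> r" "incseq u" "decseq l'"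
    by (rule einterval_Icc_approximation[OF lr]) (rule that)
  have lu: "l' m < u k" for m k
  proof -
    have "l' m \<le> l' 0" "u 0 \<le> u k" using u(6,7) by (auto simp: incseq_def decseq_def)
    then show ?thesis using u(1)[of 0] by simp
  qed
  have lI: "l' m \<in> ivl l r" for m
    using u(1,2,3)[of m] by (auto simp: ivl_iff intro: less_trans[of _ "ereal (u m)"])
  have uI: "u m \<in> ivl l r" for m
    using u(1,2,3)[of m] by (auto simp: ivl_iff intro: less_trans[of _ "ereal (l' m)"])
  have ab: "{l' m..u k} \<subseteq> ivl l r" for m k by (rule Icc_subset_ivl[OF lI uI])
  \<comment> \<open>Near \<open>l\<close> there is no control of \<open>w\<close>, so the bound
    starts at \<open>l' m\<close> and depends on \<open>m\<close>: continuity covers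
    \<open>[l' m, c]\<close>, the hypothesis the rest.\<close>
  have "\<exists>C. \<forall>x. l' m \<le> x \<longrightarrow> ereal x < r \<longrightarrow> w x \<le> C" for m
  proof -
    obtain C where C: "\<And>x. c \<le> x \<Longrightarrow> ereal x < r \<Longrightarrow> w x \<le> C" using bdd by blast
    have "bounded (w ` {l' m..c})"
      by (intro compact_imp_bounded compact_continuous_image continuous_on_subset[OF cont_w] Icc_subset_ivl lI c) auto
    then obtain B where B: "\<And>x. x \<in> {l' m..c} \<Longrightarrow> \<bar>w x\<bar> \<le> B" unfolding bounded_iff by force
    have "w x \<le> max B C" if "l' m \<le> x" "ereal x < r" for x
      using B[of x] C[of x] that by (cases "c \<le> x") auto
    then show ?thesis by blast
  qed
  then obtain C where C: "\<And>m x. l' m \<le> x \<Longrightarrow> ereal x < r \<Longrightarrow> w x \<le> C m" by metis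
  have C0: "0 \<le> C m" for m using C[of m "l' m"] w_nonneg[OF lI[of m]] lI[of m] by (simp add: ivl_iff)
  have "\<exists>X. martingale M F X \<and> (\<forall>\<omega> T t. \<omega> \<in> space M \<longrightarrow> exits (l' m) (u k) \<omega> T \<longrightarrow> 0 \<le> t \<longrightarrow> X t \<omega> = N \<omega> (min t T))" for m k
    using stopped_martingale[OF lu ab, of m k] by metis
  then obtain X where mart: "\<And>m k. martingale M F (X m k)"
    and XN: "\<And>m k \<omega> T t. \<omega> \<in> space M \<Longrightarrow> exits (l' m) (u k) \<omega> T \<Longrightarrow> 0 \<le> t \<Longrightarrow> X m k t \<omega> = N \<omega> (min t T)"
    by metis
  have Xi: "integrable M (X m k t)" if "0 \<le> t" for m k t
    using mart that unfolding martingale_def by blast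
  \<comment> \<open>\<open>A\<close> is \<open>w (Y) - w (Y 0) - N\<close>, with first term at most
    \<open>C m\<close> and \<open>w (Y 0)\<close> nonnegative. For \<open>T = 0\<close> the path may
    start where \<open>C m\<close> does not bound \<open>w\<close>, but then \<open>A\<close> and
    \<open>N\<close> are 0 and \<open>C m \<ge> 0\<close> is enough.\<close>
  have AleX: "A \<omega> (min t T) \<le> C m - X m k t \<omega>"
    if \<omega>: "\<omega> \<in> space M" and T: "exits (l' m) (u k) \<omega> T" and t: "0 \<le> t" for m k \<omega> T t
  proof (cases "T = 0")
    case True
    then show ?thesis using XN[OF \<omega> T t] t C0[of m] by (simp add: N_0 A_0)
  next
    case False
    have T': "0 \<le> T" "ereal T < \<zeta> \<omega>" using T by (auto simp: exits_def)
    have mz: "ereal (min t T) < \<zeta> \<omega>" using T'(2) by (auto simp: min_less_iff_disj)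
    have "Y (min t T) \<omega> \<in> {l' m..u k}" using T False t T' by (auto simp: exits_def)
    then have "w (Y (min t T) \<omega>) \<le> C m" using ab[of m k] by (intro C) (auto simp: ivl_iff)
    moreover have "0 \<le> w (Y 0 \<omega>)" using path(1,3)[OF \<omega>] by (intro w_nonneg) (simp add: zero_ereal_def)
    ultimately show ?thesis using XN[OF \<omega> T t] by (simp add: N_def)
  qed
  \<comment> \<open>The level \<open>1 + R\<close> keeps the divisor in Markov's inequality positive
    at \<open>R = 0\<close>.\<close>
  define D where "D m R k n = {\<omega> \<in> space M. 1 + real R \<le> C m - X m k (real n) \<omega>}" for m R k n :: nat
  have Dm: "D m R k n \<in> events" for m R k n
  proof -
    have [measurable]: "X m k (real n) \<in> borel_measurable M" by (rule borel_measurable_integrable[OF Xi]) simp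
    show ?thesis unfolding D_def by measurable
  qed
  have "AE \<omega> in M. \<not> (\<exists>m. \<forall>R. \<forall>\<^sub>F k in sequentially. \<forall>\<^sub>F n in sequentially. \<omega> \<in> D m R k n)"
  proof (rule AE_not_eventually[OF Dm])
    fix m R :: nat
    have "prob (D m R k n) \<le> C m / (1 + real R)" for k n
    proof -
      have ex: "AE \<omega> in M. \<omega> \<in> space M \<and> (\<exists>T. exits (l' m) (u k) \<omega> T)"
        using AE_limit_space by eventually_elim (use ex_exits[OF _ u(3)] in blast)
      have "(LINT \<omega>|M. X m k (real n) \<omega>) = (LINT \<omega>|M. X m k 0 \<omega>)"
        by (rule martingale_integral_const[OF filt mart]) simp
      also have "\<dots> = 0"
      proof (rule integral_eq_zero_AE)
        show "AE \<omega> in M. X m k 0 \<omega> = 0" using ex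
        proof eventually_elim
          case (elim \<omega>)
          then obtain T where T: "exits (l' m) (u k) \<omega> T" and \<omega>: "\<omega> \<in> space M" by auto
          then show ?case using XN[OF \<omega> T, of 0] by (simp add: exits_def N_0 min_absorb1)
        qed
      qed
      \<comment> \<open>The stopped martingale has mean 0, so the mean of \<open>C m - X\<close> is
        \<open>C m\<close> whatever \<open>k\<close> and \<open>n\<close> are.\<close>
      finally have E: "(LINT \<omega>|M. C m - X m k (real n) \<omega>) = C m"
        using Xi[of "real n" m k] by (simp add: prob_space)
      have "prob {\<omega> \<in> space M. 1 + real R \<le> C m - X m k (real n) \<omega>} \<le> (LINT \<omega>|M. C m - X m k (real n) \<omega>) / (1 + real R)"
      proof (rule integral_Markov_inequality_measure[where A = "space M"])
        show "AE \<omega> in M. 0 \<le> C m - X m k (real n) \<omega>" using ex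
        proof eventually_elim
          case (elim \<omega>)
          then obtain T where T: "exits (l' m) (u k) \<omega> T" and \<omega>: "\<omega> \<in> space M" by auto
          have "0 \<le> A \<omega> (min (real n) T)"
            using T by (intro A_nonneg[OF \<omega>]) (auto simp: exits_def min_less_iff_disj)
          then show ?case using AleX[OF \<omega> T, of "real n"] by simp
        qed
      qed (use Xi[of "real n" m k] in auto)
      then show ?thesis unfolding D_def E .
    qed
    then show "\<forall>\<^sub>F k in sequentially. \<forall>\<^sub>F n in sequentially. prob (D m R k n) \<le> C m / (1 + real R)"
      by simp
  qed
  with AE_limit_space show ?thesis
  proof eventually_elim
    case (elim \<omega>)
    then have \<omega>: "\<omega> \<in> space M" and lim: "((\<lambda>t. ereal (Y t \<omega>)) \<longlongrightarrow> r) (at_left_e (\<zeta> \<omega>))" by auto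
    show ?case
    proof (rule ccontr)
      assume "\<not> additive_functional Y \<zeta> f \<omega> < \<infinity>"
      then have unb: "\<exists>t\<ge>0. ereal t < \<zeta> \<omega> \<and> R < A \<omega> t" for R
        using additive_functional_finite_iff[OF \<omega>] by (metis not_le)
      \<comment> \<open>From some time on the path is above \<open>c\<close>, and before that it is
        bounded below inside the state interval; some \<open>l' m\<close> lies under both.\<close>
      obtain m where m: "\<And>t. 0 \<le> t \<Longrightarrow> ereal t < \<zeta> \<omega> \<Longrightarrow> l' m < Y t \<omega>"
      proof -
        obtain t0 where t0: "0 \<le> t0" "ereal t0 < \<zeta> \<omega>" "\<And>t. t0 \<le> t \<Longrightarrow> ereal t < \<zeta> \<omega> \<Longrightarrow> c < Y t \<omega>"
          using limit_eventually[OF lim _ \<omega>, of c] c by (auto simp: ivl_iff)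
        obtain y1 y2 where y: "y1 \<in> ivl l r" "\<And>s. 0 \<le> s \<Longrightarrow> s \<le> t0 \<Longrightarrow> y1 \<le> Y s \<omega>"
          using path_range[OF \<omega> t0(1,2)] by metis
        have "\<forall>\<^sub>F m in sequentially. ereal (l' m) < ereal (min y1 c)"
          using y(1) c by (intro order_tendstoD(2)[OF u(4)]) (simp add: ivl_iff min_def)
        then obtain m where "l' m < min y1 c" by (auto simp: eventually_sequentially)
        then have "l' m < Y t \<omega>" if "0 \<le> t" "ereal t < \<zeta> \<omega>" for t
          using y(2)[of t] t0(3)[of t] that by (cases "t \<le> t0") auto
        then show thesis by (rule that)
      qed
      have "\<forall>\<^sub>F k in sequentially. \<forall>\<^sub>F n in sequentially. \<omega> \<in> D m R k n" for R
      proof -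
        obtain t0 where t0: "0 \<le> t0" "ereal t0 < \<zeta> \<omega>" "1 + real R < A \<omega> t0"
          using unb by blast
        obtain y1 y2 where y: "y2 \<in> ivl l r" "\<And>s. 0 \<le> s \<Longrightarrow> s \<le> t0 \<Longrightarrow> Y s \<omega> \<le> y2"
          using path_range[OF \<omega> t0(1,2)] by metis
        have "\<forall>\<^sub>F k in sequentially. ereal y2 < ereal (u k)"
          using y(1) by (intro order_tendstoD(1)[OF u(5)]) (simp add: ivl_iff)
        then show ?thesis
        proof eventually_elim
          case (elim k)
          obtain T where T: "exits (l' m) (u k) \<omega> T" using ex_exits[OF lim u(3) \<omega>] by blast
          have T': "0 \<le> T" "ereal T < \<zeta> \<omega>" using T by (auto simp: exits_def)
          \<comment> \<open>As \<open>A\<close> grows with time, its value at the later exit still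
            exceeds \<open>1 + R\<close>, and the stopped process keeps its exit value for all
            \<open>n\<close> beyond \<open>T\<close>.\<close>
          have tT: "t0 < T"
          proof (rule exits_unbounded[OF \<omega> t0(1,2) T])
            fix s assume s: "0 \<le> s" "s \<le> t0"
            then have "ereal s < \<zeta> \<omega>" using t0(2) by (auto intro: le_less_trans[of _ "ereal t0"])
            with y(2)[OF s] m[OF s(1)] elim show "Y s \<omega> \<in> {l' m<..<u k}" by auto
          qed
          obtain n0 :: nat where n0: "T < real n0" using reals_Archimedean2 by blast
          have "\<omega> \<in> D m R k n" if n: "n0 \<le> n" for n
          proof -
            have "real n0 \<le> real n" using n by simp
            then have "A \<omega> T \<le> C m - X m k (real n) \<omega>" using AleX[OF \<omega> T, of "real n"] n0 by (simp add: min_absorb2)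
            moreover have "A \<omega> t0 \<le> A \<omega> T" using tT T' by (intro A_mono[OF \<omega> t0(1)]) auto
            ultimately show ?thesis using \<omega> t0(3) by (simp add: D_def)
          qed
          then show ?case unfolding eventually_sequentially by blast
        qed
      qed
      with elim show False by blast
    qed
  qed
qed

end

section \<open>The integral criteria\<close>

context diffusion_coefficients
begin

lemma Icc_sub: "x \<in> ivl l r \<Longrightarrow> {c..x} \<subseteq> ivl l r"
  by (rule Icc_subset_ivl[OF c])

lemma right_sub: "{x. c \<le> x \<and> ereal x < r} \<subseteq> ivl l r"
  using c by (auto simp: ivl_iff) (metis ereal_less_eq(3) less_le_trans)

lemma Q_nonneg: "c \<le> x \<Longrightarrow> x \<in> ivl l r \<Longrightarrow> 0 \<le> Q x"
  using Q_mono[OF c, of x] by (simp add: Q_c)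

text \<open>On \<open>c < v < x < r\<close>, integrating over \<open>v\<close> first leaves the
  scale density times \<open>Q\<close>, that is \<open>w1\<close>, whose primitive is
  \<open>w\<close>.\<close>

lemma Y_integral_finite_iff:
  "Y_integral \<sigma> b f r c < \<infinity> \<longleftrightarrow> (\<exists>C. \<forall>x. c \<le> x \<longrightarrow> ereal x < r \<longrightarrow> w x \<le> C)"
proof -
  let ?S = "{x. c < x \<and> ereal x < r}"
  have S[measurable]: "?S \<in> sets borel"
    using borel_einterval[of "ereal c" r] by (simp add: einterval_def)
  have SI: "?S \<subseteq> ivl l r" using right_sub by auto
  have meas: "(\<lambda>x. ennreal (h x) * indicator ?S x) \<in> borel_measurable borel"
    if "continuous_on (ivl l r) h" for h
  proof -
    have "(\<lambda>x. indicator ?S x *\<^sub>R h x) \<in> borel_measurable borel"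
      using S by (intro borel_measurable_continuous_on_indicator continuous_on_subset[OF that SI]) auto
    then have "(\<lambda>x. ennreal (indicator ?S x *\<^sub>R h x)) \<in> borel_measurable borel" by measurable
    also have "(\<lambda>x. ennreal (indicator ?S x *\<^sub>R h x)) = (\<lambda>x. ennreal (h x) * indicator ?S x)"
      by (auto simp: indicator_def fun_eq_iff)
    finally show ?thesis .
  qed
  \<comment> \<open>Both densities carry the indicator of \<open>(c, r)\<close>, as nothing is known
    of their measurability outside the state interval; the order \<open>v < x\<close> becomes a
    separate indicator, ready for the exchange.\<close>
  define P where "P x = ennreal (scale_density x) * indicator ?S x" for x
  define q where "q v = ennreal (speed_f v) * indicator ?S v" for v
  have [measurable]: "P \<in> borel_measurable borel" "q \<in> borel_measurable borel"
    unfolding P_def q_def by (intro meas cont_scale cont_speed)+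
  have "Y_integral \<sigma> b f r c = (\<integral>\<^sup>+v. (\<integral>\<^sup>+x. P x * q v * indicator {v<..} x \<partial>lborel) \<partial>lborel)"
    unfolding Y_integral_def
  proof (rule nn_integral_cong)
    fix v
    show "(\<integral>\<^sup>+ x\<in>{x. v < x \<and> ereal x < r}. ennreal (exp (- BY \<sigma> b c x)) \<partial>lborel) *
        ennreal (f v) * ennreal (2 / (\<sigma> v)\<^sup>2 * exp (BY \<sigma> b c v)) * indicator ?S v =
      (\<integral>\<^sup>+x. P x * q v * indicator {v<..} x \<partial>lborel)"
    proof (cases "v \<in> ?S")
      case True
      have "ennreal (f v) * ennreal (2 / (\<sigma> v)\<^sup>2 * exp (BY \<sigma> b c v)) = q v"
        using True SI f_pos[of v] by (auto simp: q_def speed_f_def ennreal_mult'[symmetric])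
      moreover have "(\<integral>\<^sup>+ x\<in>{x. v < x \<and> ereal x < r}. ennreal (exp (- BY \<sigma> b c x)) \<partial>lborel) =
        (\<integral>\<^sup>+x. P x * indicator {v<..} x \<partial>lborel)"
        using True by (intro nn_integral_cong) (auto simp: P_def scale_density_def indicator_def)
      moreover have "(\<integral>\<^sup>+x. P x * q v * indicator {v<..} x \<partial>lborel) = (\<integral>\<^sup>+x. P x * indicator {v<..} x \<partial>lborel) * q v"
        by (subst nn_integral_multc[symmetric]) (auto simp: mult_ac)
      ultimately show ?thesis using True by (simp add: mult.assoc)
    qed (auto simp: q_def)
  qed
  also have "\<dots> = (\<integral>\<^sup>+x. (\<integral>\<^sup>+v. P x * q v * indicator {v<..} x \<partial>lborel) \<partial>lborel)"
  proof (rule lborel_pair.Fubini'[where f = "\<lambda>x v. P x * q v * indicator {v<..} x"])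
    have "{z \<in> space (borel \<Otimes>\<^sub>M borel). snd z < (fst z :: real)} \<in> sets (borel \<Otimes>\<^sub>M borel)" by measurable
    then have [measurable]: "{z. snd z < (fst z :: real)} \<in> sets (borel \<Otimes>\<^sub>M borel)" by (simp add: space_pair_measure)
    have "(\<lambda>z. P (fst z) * q (snd z) * indicator {z. snd z < fst z} z) \<in> borel_measurable (lborel \<Otimes>\<^sub>M lborel)"
      by measurable
    then show "(\<lambda>(x, v). P x * q v * indicator {v<..} x) \<in> borel_measurable (lborel \<Otimes>\<^sub>M lborel)"
      by (simp add: case_prod_beta' indicator_def)
  qed
  also have "\<dots> = (\<integral>\<^sup>+x\<in>?S. ennreal (w1 x) \<partial>lborel)"
  proof (rule nn_integral_cong)
    fix x
    show "(\<integral>\<^sup>+v. P x * q v * indicator {v<..} x \<partial>lborel) = ennreal (w1 x) * indicator ?S x"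
    proof (cases "x \<in> ?S")
      case True
      then have xI: "x \<in> ivl l r" using SI by auto
      have "(\<integral>\<^sup>+v. P x * q v * indicator {v<..} x \<partial>lborel) =
        (\<integral>\<^sup>+v. P x * (ennreal (speed_f v) * indicator {c<..<x} v) \<partial>lborel)"
        using True by (intro nn_integral_cong)
          (auto simp: q_def indicator_def intro: less_trans[of "ereal _" "ereal x"])
      also have "\<dots> = P x * (\<integral>\<^sup>+v\<in>{c<..<x}. ennreal (speed_f v) \<partial>lborel)"
      proof (rule nn_integral_cmult)
        have "(\<lambda>v. q v * indicator {c<..<x} v) \<in> borel_measurable lborel" by measurable
        also have "(\<lambda>v. q v * indicator {c<..<x} v) = (\<lambda>v. ennreal (speed_f v) * indicator {c<..<x} v)"
          using True by (auto simp: fun_eq_iff q_def indicator_def intro: less_trans[of "ereal _" "ereal x"])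
        finally show "(\<lambda>v. ennreal (speed_f v) * indicator {c<..<x} v) \<in> borel_measurable lborel" .
      qed
      also have "(\<integral>\<^sup>+v\<in>{c<..<x}. ennreal (speed_f v) \<partial>lborel) = ennreal (Q x - Q c)"
        using True Icc_sub[OF xI] by (intro nn_integral_Ioo_derivative continuous_on_subset[OF cont_speed] Q_deriv)
          (auto intro!: less_imp_le[OF speed_pos])
      finally show ?thesis
        using True scale_pos[of x] by (simp add: P_def Q_c w1_def ennreal_mult')
    qed (simp add: P_def)
  qed
  finally have eq: "Y_integral \<sigma> b f r c = (\<integral>\<^sup>+x\<in>?S. ennreal (w1 x) \<partial>lborel)" .
  show ?thesis
    unfolding eq
  proof (rule nn_integral_derivative_finite_iff)
    show "ereal c < r" using c by (simp add: ivl_iff)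
    show "continuous_on {x. c \<le> x \<and> ereal x < r} w1" by (rule continuous_on_subset[OF cont_w1 right_sub])
    fix x assume x: "c \<le> x" "ereal x < r"
    then have xI: "x \<in> ivl l r" using right_sub by auto
    show "0 \<le> w1 x" using Q_nonneg[OF x(1) xI] scale_pos[of x] by (simp add: w1_def)
    show "(w has_real_derivative w1 x) (at x)" by (rule w_deriv[OF xI])
  qed
qed

end

section \<open>The change of variable z = g(x)\<close>

locale space_transform =
  fixes l r gl gr :: ereal and g g1 :: "real \<Rightarrow> real"
  assumes g_mono: "mono_on (ivl l r) g"
    and g1: "\<And>x. x \<in> ivl l r \<Longrightarrow> (g has_real_derivative g1 x) (at x)"
    and g1_ne: "\<And>x. x \<in> ivl l r \<Longrightarrow> g1 x \<noteq> 0"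
    and gl: "((\<lambda>x. ereal (g x)) \<longlongrightarrow> gl) (at_right_e l)"
    and gr: "((\<lambda>x. ereal (g x)) \<longlongrightarrow> gr) (at_left_e r)"
begin

abbreviation ginv where "ginv \<equiv> inv_into (ivl l r) g"

text \<open>A negative derivative would make \<open>g\<close> drop just to the right of
  \<open>x\<close>. Weak monotonicity gives no more than a nonnegative derivative;
  \<open>g1_ne\<close>, which reflects the positivity of \<open>f\<close>, excludes 0.\<close>

lemma g1_pos:
  assumes x: "x \<in> ivl l r" shows "0 < g1 x"
proof -
  have "0 \<le> g1 x"
  proof (rule ccontr)
    assume "\<not> 0 \<le> g1 x"
    then obtain d where d: "0 < d" "\<And>h. 0 < h \<Longrightarrow> h < d \<Longrightarrow> g (x + h) < g x"
      using DERIV_neg_dec_right[OF g1[OF x]] by auto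
    obtain e where e: "0 < e" "ball x e \<subseteq> ivl l r" using open_ivl x open_contains_ball by blast
    define h where "h = min d e / 2"
    have h: "0 < h" "h < d" "h < e" using d e by (auto simp: h_def)
    have "x + h \<in> ivl l r" using e h by (auto simp: subset_iff dist_real_def)
    then have "g x \<le> g (x + h)" using h x by (intro mono_onD[OF g_mono]) auto
    then show False using d(2)[OF h(1,2)] by simp
  qed
  then show ?thesis using g1_ne[OF x] by simp
qed

lemma g_less:
  assumes "x \<in> ivl l r" "y \<in> ivl l r" "x < y" shows "g x < g y"
  by (rule DERIV_pos_imp_increasing[OF assms(3)])
    (use Icc_subset_ivl[OF assms(1,2)] g1 g1_pos in force)

lemma g_less_iff: "x \<in> ivl l r \<Longrightarrow> y \<in> ivl l r \<Longrightarrow> g x < g y \<longleftrightarrow> x < y"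
  using g_less[of x y] g_less[of y x] by (cases x y rule: linorder_cases) auto

lemma inj_g: "inj_on g (ivl l r)"
  by (rule inj_onI) (metis g_less less_irrefl linorder_neqE)

lemma ginv_g[simp]: "x \<in> ivl l r \<Longrightarrow> ginv (g x) = x"
  by (rule inv_into_f_f[OF inj_g])

lemma cont_g: "continuous_on (ivl l r) g"
  by (intro continuous_at_imp_continuous_on ballI DERIV_isCont[OF g1])

text \<open>An intermediate point \<open>y\<close> yields strictness: the limit at the end bounds
  \<open>g y\<close> weakly, and strict monotonicity separates \<open>g y\<close> from
  \<open>g x\<close>.\<close>

lemma g_range:
  assumes x: "x \<in> ivl l r" shows "gl < ereal (g x)" "ereal (g x) < gr"
proof -
  obtain y where y: "l < ereal y" "ereal y < ereal x" using ereal_dense2[of l "ereal x"] x by (auto simp: ivl_iff)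
  then have yI: "y \<in> ivl l r" using x less_trans[of "ereal y" "ereal x" r] by (simp add: ivl_iff)
  have "gl \<le> ereal (g y)"
  proof (rule ccontr)
    assume "\<not> gl \<le> ereal (g y)"
    then have "\<forall>\<^sub>F x in at_right_e l. ereal (g y) < ereal (g x)" by (intro order_tendstoD(1)[OF gl]) simp
    then obtain t0 where t0: "t0 \<le> y" "l < ereal t0" "\<And>t. t < t0 \<Longrightarrow> l < ereal t \<Longrightarrow> ereal (g y) < ereal (g t)"
      by (rule eventually_at_right_eD[OF _ y(1)]) blast
    obtain t where t: "l < ereal t" "ereal t < ereal t0" using ereal_dense2[OF t0(2)] by auto
    then have "t \<in> ivl l r" using t0(1) yI by (auto simp: ivl_iff intro: less_trans[of _ "ereal y"])
    then have "g t < g y" using t t0(1) yI by (intro g_less) auto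
    then show False using t0(3)[of t] t by auto
  qed
  also have "ereal (g y) < ereal (g x)" using g_less[OF yI x] y by simp
  finally show "gl < ereal (g x)" .
  obtain y where y: "ereal x < ereal y" "ereal y < r" using ereal_dense2[of "ereal x" r] x by (auto simp: ivl_iff)
  then have yI: "y \<in> ivl l r" using x less_trans[of l "ereal x" "ereal y"] by (simp add: ivl_iff)
  have "ereal (g x) < ereal (g y)" using g_less[OF x yI] y by simp
  also have "ereal (g y) \<le> gr"
  proof (rule ccontr)
    assume "\<not> ereal (g y) \<le> gr"
    then have "\<forall>\<^sub>F x in at_left_e r. ereal (g x) < ereal (g y)" by (intro order_tendstoD(2)[OF gr]) simp
    then obtain t0 where t0: "y \<le> t0" "ereal t0 < r" "\<And>t. t0 < t \<Longrightarrow> ereal t < r \<Longrightarrow> ereal (g t) < ereal (g y)"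
      by (rule eventually_at_left_eD[OF _ y(2)]) blast
    obtain t where t: "ereal t0 < ereal t" "ereal t < r" using ereal_dense2[OF t0(2)] by auto
    then have "t \<in> ivl l r" using t0(1) yI by (auto simp: ivl_iff intro: less_trans[of _ "ereal y"])
    then have "g y < g t" using t t0(1) yI by (intro g_less) auto
    then show False using t0(3)[of t] t by auto
  qed
  finally show "ereal (g x) < gr" .
qed

lemma g_surj:
  assumes lr: "l < r" and \<alpha>: "gl < ereal \<alpha>" "ereal \<alpha> < gr"
  obtains x where "x \<in> ivl l r" "\<alpha> = g x"
proof -
  obtain y where y: "l < ereal y" "ereal y < r" using ereal_dense2[OF lr] by auto
  have "\<forall>\<^sub>F x in at_right_e l. ereal (g x) < ereal \<alpha>" by (rule order_tendstoD(2)[OF gl \<alpha>(1)])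
  then obtain t0 where t0: "t0 \<le> y" "l < ereal t0" "\<And>t. t < t0 \<Longrightarrow> l < ereal t \<Longrightarrow> ereal (g t) < ereal \<alpha>"
    by (rule eventually_at_right_eD[OF _ y(1)]) blast
  obtain x1 where x1: "l < ereal x1" "ereal x1 < ereal t0" using ereal_dense2[OF t0(2)] by auto
  have "\<forall>\<^sub>F x in at_left_e r. ereal \<alpha> < ereal (g x)" by (rule order_tendstoD(1)[OF gr \<alpha>(2)])
  then obtain t1 where t1: "y \<le> t1" "ereal t1 < r" "\<And>t. t1 < t \<Longrightarrow> ereal t < r \<Longrightarrow> ereal \<alpha> < ereal (g t)"
    by (rule eventually_at_left_eD[OF _ y(2)]) blast
  obtain x2 where x2: "ereal t1 < ereal x2" "ereal x2 < r" using ereal_dense2[OF t1(2)] by auto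
  have x12: "x1 \<le> x2" using x1 x2 t0 t1 by simp
  have I: "x1 \<in> ivl l r" "x2 \<in> ivl l r"
    using x1 x2 x12 by (auto simp: ivl_iff intro: le_less_trans[of _ "ereal x2"] less_le_trans[of _ "ereal x1"])
  have "\<exists>x\<ge>x1. x \<le> x2 \<and> g x = \<alpha>"
    using t0(3)[of x1] t1(3)[of x2] x1 x2 x12
    by (intro IVT' continuous_on_subset[OF cont_g Icc_subset_ivl[OF I]]) auto
  then show thesis using that Icc_subset_ivl[OF I] by auto
qed

lemma ginv_deriv:
  assumes x: "x \<in> ivl l r"
  shows "(ginv has_real_derivative 1 / g1 x) (at (g x))"
proof -
  obtain e where e: "0 < e" "cball x e \<subseteq> ivl l r" using open_ivl x open_contains_cball by blast
  have eI: "z \<in> ivl l r" if "\<bar>z - x\<bar> \<le> e" for z using e that by (auto simp: subset_iff dist_real_def abs_minus_commute)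
  have I: "x - e \<in> ivl l r" "x + e \<in> ivl l r" using e by (auto intro!: eI)
  have "isCont ginv (g x)"
    by (rule isCont_inverse_function[of e]) (use e eI in \<open>auto intro: DERIV_isCont[OF g1]\<close>)
  \<comment> \<open>\<open>ginv\<close> inverts \<open>g\<close> only on the range of
    \<open>g\<close>, which contains this neighbourhood of \<open>g x\<close>.\<close>
  moreover have "g (ginv y) = y" if "g (x - e) < y" "y < g (x + e)" for y
  proof -
    have "gl < ereal y" "ereal y < gr"
      using less_trans[of gl "ereal (g (x - e))" "ereal y"] less_trans[of "ereal y" "ereal (g (x + e))" gr]
        g_range(1)[OF I(1)] g_range(2)[OF I(2)] that by auto
    then have "y \<in> g ` ivl l r" using g_surj x by (metis image_eqI ivl_iff less_trans)
    then show ?thesis by (rule f_inv_into_f)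
  qed
  ultimately show ?thesis
    using DERIV_inverse_function[of g "g1 x" ginv "g x" "g (x - e)" "g (x + e)"] g1[OF x] g1_ne[OF x] g_less e I x
    by (simp add: inverse_eq_divide)
qed

end

text \<open>In the coordinate \<open>x\<close>, the exponential of \<open>B^Z\<close> is
  \<open>g1 / g1 c\<close> times that of \<open>B^Y\<close>, so \<open>m^Z\<close> pulls back to
  \<open>f m^Y / g1 c\<close> and \<open>S^Z\<close> to \<open>g1 c * S^Y\<close>. The factors
  cancel, and the outer integrand is the derivative of \<open>w\<close> composed with
  \<open>ginv\<close>. Primitives take the place of a substitution rule.\<close>

lemma Z_exit_integral_finite_iff:
  assumes "diffusion_coefficients l r \<sigma> b f c" "space_transform l r gl gr g g1"
    and g2: "\<And>x. x \<in> ivl l r \<Longrightarrow> (g1 has_real_derivative g2 x) (at x)"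
    and g2_cont: "continuous_on (ivl l r) g2"
    and f_eq: "\<And>x. x \<in> ivl l r \<Longrightarrow> f x = (g1 x * \<sigma> x)\<^sup>2"
  shows "Z_exit_integral (ivl l r) g (driftG \<sigma> b f g1 g2) gr (g c) < \<infinity> \<longleftrightarrow>
    (\<exists>C. \<forall>x. c \<le> x \<longrightarrow> ereal x < r \<longrightarrow> diffusion_coefficients.w \<sigma> b f c x \<le> C)"
proof -
  interpret diffusion_coefficients l r \<sigma> b f c by fact
  interpret space_transform l r gl gr g g1 by fact
  have lr: "l < r" using c by (auto simp: ivl_iff intro: less_trans)
  let ?J = "{z. gl < ereal z \<and> ereal z < gr}"
  have Jg: "z \<in> ?J \<longleftrightarrow> z \<in> g ` ivl l r" for z
    using g_surj[OF lr, of z] g_range by auto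
  have Jx: "\<exists>x. x \<in> ivl l r \<and> z = g x" if "z \<in> ?J" for z using that Jg by blast
  have cJ: "g c \<in> ivl gl gr" using g_range[OF c] by (simp add: ivl_iff)
  have giI: "ginv z \<in> ivl l r" "g (ginv z) = z" if "z \<in> ivl gl gr" for z
    using Jx[of z] that by (auto simp: ivl_iff)
  have dgi: "(ginv has_real_derivative 1 / g1 (ginv z)) (at z)" if "z \<in> ivl gl gr" for z
    using ginv_deriv[OF giI(1)[OF that]] giI(2)[OF that] by simp
  have cgi: "continuous_on (ivl gl gr) ginv"
    by (intro continuous_at_imp_continuous_on ballI DERIV_isCont[OF dgi])
  have comp: "continuous_on (ivl gl gr) (\<lambda>z. h (ginv z))" if "continuous_on (ivl l r) h" for h :: "real \<Rightarrow> real"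
    by (rule continuous_on_compose2[OF that cgi]) (use giI in auto)
  have cg1: "continuous_on (ivl l r) g1"
    by (intro continuous_at_imp_continuous_on ballI DERIV_isCont[OF g2])
  let ?G = "driftG \<sigma> b f g1 g2"
  have cG: "continuous_on (ivl gl gr) (\<lambda>z. ?G (ginv z))"
  proof (rule comp)
    show "continuous_on (ivl l r) ?G" unfolding driftG_def
      by (intro continuous_intros cont_f cont_b cont_sigma cg1 g2_cont) (use f_pos in force)
  qed
  have sub: "{g c..z} \<subseteq> ivl gl gr" if "z \<in> ivl gl gr" for z by (rule Icc_subset_ivl[OF cJ that])
  have gic: "c \<le> ginv z" if "g c \<le> z" "z \<in> ivl gl gr" for z
    using g_less_iff[OF giI(1)[OF that(2)] c] giI(2)[OF that(2)] that(1) by auto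
  have Bz: "BZ (ivl l r) g ?G (g c) z = ln (g1 (ginv z)) - ln (g1 c) + BY \<sigma> b c (ginv z)"
    if z: "g c \<le> z" "z \<in> ivl gl gr" for z
  proof -
    \<comment> \<open>As \<open>f = (g1 \<sigma>)^2\<close>, twice the drift is
      \<open>g2 / g1^2 + 2 b / (\<sigma>^2 g1)\<close>. Since \<open>ginv\<close> has derivative
      \<open>1 / g1\<close>, the first term comes from \<open>ln g1\<close> and the second from
      \<open>BY\<close>.\<close>
    let ?\<Phi> = "\<lambda>z. (ln (g1 (ginv z)) + BY \<sigma> b c (ginv z)) / 2"
    have "(LBINT y=ereal (g c)..ereal z. ?G (ginv y)) = ?\<Phi> z - ?\<Phi> (g c)"
    proof (rule interval_integral_FTC_finite)
      show "continuous_on {min (g c) z..max (g c) z} (\<lambda>y. ?G (ginv y))"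
        using z sub[OF z(2)] by (intro continuous_on_subset[OF cG]) auto
      fix y assume "min (g c) z \<le> y" "y \<le> max (g c) z"
      then have y: "y \<in> ivl gl gr" using z sub[OF z(2)] by auto
      let ?x = "ginv y"
      have x: "?x \<in> ivl l r" by (rule giI[OF y])
      have "(?\<Phi> has_real_derivative
        (g2 ?x * (1 / g1 ?x) / g1 ?x + 2 * (b ?x / (\<sigma> ?x)\<^sup>2) * (1 / g1 ?x)) / 2) (at y)"
        using g1_pos[OF x]
        by (auto intro!: derivative_eq_intros DERIV_chain2[OF g2[OF x] dgi[OF y]] DERIV_chain2[OF BY_deriv[OF x] dgi[OF y]]
          simp: field_simps)
      also have "(g2 ?x * (1 / g1 ?x) / g1 ?x + 2 * (b ?x / (\<sigma> ?x)\<^sup>2) * (1 / g1 ?x)) / 2 = ?G ?x"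
        using g1_pos[OF x] sigma_pos[OF x] by (simp add: driftG_def f_eq[OF x] field_simps power2_eq_square)
      finally show "(?\<Phi> has_vector_derivative ?G ?x) (at y within {min (g c) z..max (g c) z})"
        by (simp add: has_real_derivative_iff_has_vector_derivative has_vector_derivative_at_within)
    qed
    then show ?thesis using c by (simp add: BZ_def BY_def field_simps)
  qed
  have expB: "exp (BZ (ivl l r) g ?G (g c) z) = g1 (ginv z) / g1 c * exp (BY \<sigma> b c (ginv z))"
    if z: "g c \<le> z" "z \<in> ivl gl gr" for z
    using g1_pos[OF c] g1_pos[OF giI(1)[OF z(2)]] unfolding Bz[OF z] by (simp add: exp_add exp_diff)
  have gcgr: "ereal (g c) < gr" using cJ by (simp add: ivl_iff)
  have gJ: "z \<in> ivl gl gr" if "g c \<le> z" "ereal z < gr" for z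
    using that cJ by (auto simp: ivl_iff intro: less_le_trans[of _ "ereal (g c)"])
  have inner: "(\<integral>\<^sup>+ \<beta>\<in>{g c<..<\<alpha>}. ennreal (2 * exp (BZ (ivl l r) g ?G (g c) \<beta>)) \<partial>lborel) =
      ennreal (Q (ginv \<alpha>) / g1 c)" if \<alpha>: "g c < \<alpha>" "ereal \<alpha> < gr" for \<alpha>
  proof -
    have \<alpha>J: "\<alpha> \<in> ivl gl gr" using gJ \<alpha> by auto
    define h where "h \<beta> = 2 * (g1 (ginv \<beta>) / g1 c * exp (BY \<sigma> b c (ginv \<beta>)))" for \<beta>
    have "(\<integral>\<^sup>+ \<beta>\<in>{g c<..<\<alpha>}. ennreal (2 * exp (BZ (ivl l r) g ?G (g c) \<beta>)) \<partial>lborel) =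
      (\<integral>\<^sup>+ \<beta>\<in>{g c<..<\<alpha>}. ennreal (h \<beta>) \<partial>lborel)"
      using sub[OF \<alpha>J] by (intro nn_integral_cong) (auto simp: indicator_def expB h_def subset_iff)
    also have "\<dots> = ennreal (Q (ginv \<alpha>) / g1 c - Q (ginv (g c)) / g1 c)"
    proof (rule nn_integral_Ioo_derivative)
      show "g c \<le> \<alpha>" using \<alpha> by simp
      show "continuous_on {g c..\<alpha>} h" unfolding h_def
        using g1_pos[OF c]
        by (intro continuous_on_subset[OF _ sub[OF \<alpha>J]] continuous_intros comp cg1 cont_BY) auto
      fix \<beta> assume "\<beta> \<in> {g c..\<alpha>}"
      then have \<beta>: "\<beta> \<in> ivl gl gr" using sub[OF \<alpha>J] by auto
      let ?x = "ginv \<beta>"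
      have x: "?x \<in> ivl l r" by (rule giI[OF \<beta>])
      show "0 \<le> h \<beta>" using g1_pos[OF c] g1_pos[OF x] by (simp add: h_def)
      have "((\<lambda>\<beta>. Q (ginv \<beta>) / g1 c) has_real_derivative speed_f ?x * (1 / g1 ?x) / g1 c) (at \<beta>)"
        by (intro DERIV_cdivide DERIV_chain2[OF Q_deriv[OF x] dgi[OF \<beta>]])
      also have "speed_f ?x * (1 / g1 ?x) / g1 c = h \<beta>"
        using g1_pos[OF x] sigma_pos[OF x]
        by (simp add: speed_f_def h_def f_eq[OF x] field_simps power2_eq_square)
      finally show "((\<lambda>\<beta>. Q (ginv \<beta>) / g1 c) has_real_derivative h \<beta>) (at \<beta>)" .
    qed
    finally show ?thesis using c by (simp add: Q_c)
  qed
  have eq: "Z_exit_integral (ivl l r) g ?G gr (g c) =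
    (\<integral>\<^sup>+\<alpha>\<in>{\<alpha>. g c < \<alpha> \<and> ereal \<alpha> < gr}. ennreal (w1 (ginv \<alpha>) / g1 (ginv \<alpha>)) \<partial>lborel)"
    unfolding Z_exit_integral_def
  proof (rule nn_integral_cong)
    fix \<alpha>
    show "ennreal (exp (- BZ (ivl l r) g ?G (g c) \<alpha>)) *
        (\<integral>\<^sup>+ \<beta>\<in>{g c<..<\<alpha>}. ennreal (2 * exp (BZ (ivl l r) g ?G (g c) \<beta>)) \<partial>lborel) * indicator {\<alpha>. g c < \<alpha> \<and> ereal \<alpha> < gr} \<alpha>
      = ennreal (w1 (ginv \<alpha>) / g1 (ginv \<alpha>)) * indicator {\<alpha>. g c < \<alpha> \<and> ereal \<alpha> < gr} \<alpha>"
    proof (cases "g c < \<alpha> \<and> ereal \<alpha> < gr")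
      case True
      then have \<alpha>: "\<alpha> \<in> ivl gl gr" using gJ by auto
      have "exp (- BZ (ivl l r) g ?G (g c) \<alpha>) * (Q (ginv \<alpha>) / g1 c) = w1 (ginv \<alpha>) / g1 (ginv \<alpha>)"
        using expB[OF _ \<alpha>] True g1_pos[OF c] g1_pos[OF giI(1)[OF \<alpha>]]
        by (simp add: exp_minus w1_def scale_density_def field_simps)
      then show ?thesis using True by (simp add: inner ennreal_mult'[symmetric])
    qed auto
  qed
  have "(\<integral>\<^sup>+\<alpha>\<in>{\<alpha>. g c < \<alpha> \<and> ereal \<alpha> < gr}. ennreal (w1 (ginv \<alpha>) / g1 (ginv \<alpha>)) \<partial>lborel) < \<infinity> \<longleftrightarrow>
    (\<exists>C. \<forall>t. g c \<le> t \<longrightarrow> ereal t < gr \<longrightarrow> w (ginv t) \<le> C)"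
  proof (rule nn_integral_derivative_finite_iff[OF gcgr,
        where h = "\<lambda>x. w1 (ginv x) / g1 (ginv x)" and H = "\<lambda>t. w (ginv t)"])
    show "continuous_on {x. g c \<le> x \<and> ereal x < gr} (\<lambda>\<alpha>. w1 (ginv \<alpha>) / g1 (ginv \<alpha>))"
    proof (rule continuous_on_subset)
      show "continuous_on (ivl gl gr) (\<lambda>\<alpha>. w1 (ginv \<alpha>) / g1 (ginv \<alpha>))"
        by (intro continuous_intros comp cg1 cont_w1) (use giI(1) g1_ne in auto)
    qed (use gJ in auto)
    fix x assume x: "g c \<le> x" "ereal x < gr"
    have xJ: "x \<in> ivl gl gr" by (rule gJ[OF x])
    show "0 \<le> w1 (ginv x) / g1 (ginv x)"
      using Q_nonneg[OF gic[OF x(1) xJ] giI(1)[OF xJ]] scale_pos[of "ginv x"] g1_pos[OF giI(1)[OF xJ]]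
      by (simp add: w1_def)
    show "((\<lambda>t. w (ginv t)) has_real_derivative w1 (ginv x) / g1 (ginv x)) (at x)"
      using DERIV_chain2[OF w_deriv[OF giI(1)[OF xJ]] dgi[OF xJ]] by simp
  qed
  \<comment> \<open>\<open>g\<close> maps \<open>[c, r)\<close> onto \<open>[g c, gr)\<close>, so
    both suprema run over the same values of \<open>w\<close>.\<close>
  also have "\<dots> \<longleftrightarrow> (\<exists>C. \<forall>x. c \<le> x \<longrightarrow> ereal x < r \<longrightarrow> w x \<le> C)"
  proof -
    have "w x \<le> C" if *: "\<forall>t. g c \<le> t \<longrightarrow> ereal t < gr \<longrightarrow> w (ginv t) \<le> C" "c \<le> x" "ereal x < r" for C x
    proof -
      have x: "x \<in> ivl l r" using * right_sub by auto
      have "g c \<le> g x" using *(2) x c by (intro mono_onD[OF g_mono]) auto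
      then show ?thesis using *(1) g_range(2)[OF x] ginv_g[OF x] by metis
    qed
    moreover have "w (ginv t) \<le> C" if *: "\<forall>x. c \<le> x \<longrightarrow> ereal x < r \<longrightarrow> w x \<le> C" "g c \<le> t" "ereal t < gr" for C t
    proof -
      have tJ: "t \<in> ivl gl gr" by (rule gJ[OF *(2,3)])
      show ?thesis using *(1) gic[OF *(2) tJ] giI(1)[OF tJ] by (simp add: ivl_iff)
    qed
    ultimately show ?thesis by blast
  qed
  finally show ?thesis
    by (subst eq)

qed

theorem theorem1:
  fixes M :: "'a measure" and F :: "real \<Rightarrow> 'a measure"
    and Y :: "real \<Rightarrow> 'a \<Rightarrow> real" and \<zeta> :: "'a \<Rightarrow> ereal"
    and l r gl gr :: ereal and \<sigma> b f g g1 g2 :: "real \<Rightarrow> real"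
  assumes lr: "l < r"
    and cont_sigma: "continuous_on (ivl l r) \<sigma>"
    and cont_b: "continuous_on (ivl l r) b"
    and sigma_pos: "\<forall>x\<in>ivl l r. \<sigma> x > 0"
    and Ydiff: "diffusion M F Y \<zeta> l r \<sigma> b"
    and Ytrans: "transient M Y \<zeta> l r"
    and Ylim: "AE \<omega> in M. ((\<lambda>t. ereal (Y t \<omega>)) \<longlongrightarrow> r) (at_left_e (\<zeta> \<omega>))"
    and f_pos: "\<forall>x\<in>ivl l r. f x > 0"
    and f_cont: "continuous_on (ivl l r) f"
    and g_mono: "mono_on (ivl l r) g"
    and g1: "\<forall>x\<in>ivl l r. (g has_real_derivative g1 x) (at x)"
    and g2: "\<forall>x\<in>ivl l r. (g1 has_real_derivative g2 x) (at x)"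
    and g2_cont: "continuous_on (ivl l r) g2"
    and f_eq: "\<forall>x\<in>ivl l r. f x = (g1 x * \<sigma> x)\<^sup>2"
    and gl: "((\<lambda>x. ereal (g x)) \<longlongrightarrow> gl) (at_right_e l)"
    and gr: "((\<lambda>x. ereal (g x)) \<longlongrightarrow> gr) (at_left_e r)"
  shows "((AE \<omega> in M. additive_functional Y \<zeta> f \<omega> < \<infinity>) \<longleftrightarrow>
            (\<exists>c. gl < ereal c \<and> ereal c < gr \<and>
               Z_exit_integral (ivl l r) g (driftG \<sigma> b f g1 g2) gr c < \<infinity>))
       \<and> ((\<exists>c. gl < ereal c \<and> ereal c < gr \<and>
               Z_exit_integral (ivl l r) g (driftG \<sigma> b f g1 g2) gr c < \<infinity>) \<longleftrightarrow>
            (\<forall>c. gl < ereal c \<and> ereal c < gr \<longrightarrow>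
               Z_exit_integral (ivl l r) g (driftG \<sigma> b f g1 g2) gr c < \<infinity>))
       \<and> ((\<exists>c. gl < ereal c \<and> ereal c < gr \<and>
               Z_exit_integral (ivl l r) g (driftG \<sigma> b f g1 g2) gr c < \<infinity>) \<longleftrightarrow>
            (\<exists>c\<in>ivl l r. Y_integral \<sigma> b f r c < \<infinity>))
       \<and> ((\<exists>c\<in>ivl l r. Y_integral \<sigma> b f r c < \<infinity>) \<longleftrightarrow>
            (\<forall>c\<in>ivl l r. Y_integral \<sigma> b f r c < \<infinity>))"
proof -
  let ?I = "ivl l r" and ?G = "driftG \<sigma> b f g1 g2"
  let ?fin = "AE \<omega> in M. additive_functional Y \<zeta> f \<omega> < \<infinity>"
  have coeff: "diffusion_coefficients l r \<sigma> b f c" if "c \<in> ?I" for c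
    using that cont_sigma cont_b f_cont sigma_pos f_pos by unfold_locales auto
  have transf: "space_transform l r gl gr g g1"
  proof
    \<comment> \<open>A zero of \<open>g1\<close> would be a zero of
      \<open>f = (g1 \<sigma>)^2\<close>.\<close>
    show "g1 x \<noteq> 0" if "x \<in> ?I" for x
      using f_pos f_eq that by force
  qed (use g_mono g1 gl gr in auto)
  then interpret space_transform l r gl gr g g1 .
  have Y: "?fin \<longleftrightarrow> Y_integral \<sigma> b f r c < \<infinity>" if c: "c \<in> ?I" for c
  proof -
    interpret diffusion_coefficients l r \<sigma> b f c by (rule coeff[OF c])
    interpret diffusion_process l r \<sigma> b f c M F Y \<zeta>
      by unfold_locales (fact Ydiff, fact Ylim)
    show ?thesis
      unfolding Y_integral_finite_iff using finite_imp_bounded bounded_imp_finite by blast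
  qed
  have Z: "Z_exit_integral ?I g ?G gr (g c) < \<infinity> \<longleftrightarrow> Y_integral \<sigma> b f r c < \<infinity>" if c: "c \<in> ?I" for c
    unfolding diffusion_coefficients.Y_integral_finite_iff[OF coeff[OF c]]
    by (rule Z_exit_integral_finite_iff[OF coeff[OF c] transf]) (use g2 g2_cont f_eq in auto)
  \<comment> \<open>The base points for Z are exactly the images \<open>g c\<close> of those for Y,
    so the two criteria can be matched point by point.\<close>
  have range: "gl < ereal z \<and> ereal z < gr \<longleftrightarrow> (\<exists>c\<in>?I. z = g c)" for z
    using g_surj[OF lr, of z] g_range by metis
  have Zfin: "Z_exit_integral ?I g ?G gr z < \<infinity> \<longleftrightarrow> ?fin" if "gl < ereal z" "ereal z < gr" for z
    using that range[of z] Y Z by blast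
  \<comment> \<open>Passing from all base points to some base point needs one to exist.\<close>
  obtain c0 where c0: "c0 \<in> ?I"
    using ereal_dense2[OF lr] by (auto simp: ivl_iff)
  have g0: "gl < ereal (g c0)" "ereal (g c0) < gr"
    by (rule g_range[OF c0])+
  show ?thesis
    using Zfin Y c0 g0 by blast
qed

end
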